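(* Let $\mu$ be a global maximum point of $f$ (not necessarily unique), of type $k$ and strength $\lambda$. Then there exists $A>0$ such that for every $a\in(0,A)$ the following holds: as $N\to\infty$, under the conditional probability $P_N(\,\cdot\mid |m_N(\sigma)-\mu|\le a)$, the random variable $\bar S_k(\sigma)=\dfrac{S_N(\sigma)-N\mu}{N^{1-1/(2k)}}$ converges in distribution to the centered Gaussian law with variance $(-\lambda)^{-1}-J^{-1}$ (which is positive) if $k=1$, and to the law with density proportional to $\exp\big(\frac{\lambda}{(2k)!}x^{2k}\big)$ if $k\ge 2$.
   Context: Let $\rho$ be a non-degenerate Borel probability measure on $\mathbb{R}$ such that $\int_{\mathbb{R}}\exp\big(\tfrac{a x^2}{2}+bx\big)\,d\rho(x)<\infty$ for all $a>0$, $b\in\mathbb{R}$. Fix $J>0$ and $h\in\mathbb{R}$. For $N\ge1$ and $\sigma=(\sigma_1,\dots,\sigma_N)\in\mathbb{R}^N$ let $H_N(\sigma)=-\frac{J}{2N}\sum_{i,j=1}^N\sigma_i\sigma_j-h\sum_{i=1}^N\sigma_i$, and let $P_N$ be the probability measure on $\mathbb{R}^N$ given by $dP_N(\sigma)=Z_N^{-1}\exp(-H_N(\sigma))\prod_{i=1}^N d\rho(\sigma_i)$, where $Z_N$ is the normalizing constant. Let $S_N(\sigma)=\sum_{i=1}^N\sigma_i$ and $m_N(\sigma)=S_N(\sigma)/N$. Define $f(x)=-\frac{J}{2}x^2+\ln\int_{\mathbb{R}}\exp\big(s(Jx+h)\big)\,d\rho(s)$. For a global maximum point $\mu$ of $f$,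 its type is the positive integer $k$ and its strength is the negative real $\lambda$ such that $f^{(j)}(\mu)=0$ for $1\le j\le 2k-1$ and $f^{(2k)}(\mu)=\lambda<0$. *)

theory Defs
  imports "HOL-Probability.Probability"
begin

text \<open>Spin configurations sigma in R^N are modelled as functions nat => real on the
index set {..<N} (product measure PiM).\<close>

definition S_N :: "nat \<Rightarrow> (nat \<Rightarrow> real) \<Rightarrow> real" where
  "S_N N \<sigma> = (\<Sum>i<N. \<sigma> i)"

definition m_N :: "nat \<Rightarrow> (nat \<Rightarrow> real) \<Rightarrow> real" where
  "m_N N \<sigma> = S_N N \<sigma> / real N"

definition H_N :: "real \<Rightarrow> real \<Rightarrow> nat \<Rightarrow> (nat \<Rightarrow> real) \<Rightarrow> real" where
  "H_N J h N \<sigma> = - (J / (2 * real N)) * (\<Sum>i<N. \<Sum>j<N. \<sigma> i * \<sigma> j) - h * (\<Sum>i<N. \<sigma> i)"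

definition Z_N :: "real measure \<Rightarrow> real \<Rightarrow> real \<Rightarrow> nat \<Rightarrow> real" where
  "Z_N \<rho> J h N = (\<integral>\<sigma>. exp (- H_N J h N \<sigma>) \<partial>(PiM {..<N} (\<lambda>_. \<rho>)))"

definition P_N :: "real measure \<Rightarrow> real \<Rightarrow> real \<Rightarrow> nat \<Rightarrow> (nat \<Rightarrow> real) measure" where
  "P_N \<rho> J h N = density (PiM {..<N} (\<lambda>_. \<rho>))
      (\<lambda>\<sigma>. ennreal (exp (- H_N J h N \<sigma>) / Z_N \<rho> J h N))"

definition f_CW :: "real measure \<Rightarrow> real \<Rightarrow> real \<Rightarrow> real \<Rightarrow> real" where
  "f_CW \<rho> J h x = - (J / 2) * x\<^sup>2 + ln (\<integral>s. exp (s * (J * x + h)) \<partial>\<rho>)"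

definition has_type_strength :: "(real \<Rightarrow> real) \<Rightarrow> real \<Rightarrow> nat \<Rightarrow> real \<Rightarrow> bool" where
  "has_type_strength f \<mu> k lam \<longleftrightarrow> k \<ge> 1 \<and>
     (\<forall>j\<in>{1..2*k-1}. (deriv ^^ j) f \<mu> = 0) \<and> (deriv ^^ (2*k)) f \<mu> = lam \<and> lam < 0"

definition S_bar :: "nat \<Rightarrow> real \<Rightarrow> nat \<Rightarrow> (nat \<Rightarrow> real) \<Rightarrow> real" where
  "S_bar k \<mu> N \<sigma> = (S_N N \<sigma> - real N * \<mu>) / (real N) powr (1 - 1 / (2 * real k))"

end

theory Submission
  imports Defs "HOL-Real_Asymp.Real_Asymp"
begin

text \<open>Weight the pair \<open>(\<sigma>, y)\<close> by \<open>exp (- N J y\<^sup>2 / 2 + (J y + h) S\<^sub>N(\<sigma>))\<close>. Integrating out \<open>\<sigma>\<close> leaves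
  \<open>exp (N f(y))\<close>, while completing the square shows that the weight is the Boltzmann factor of
  \<open>\<sigma>\<close> times a Gaussian in \<open>y\<close> of mean \<open>m\<^sub>N(\<sigma>)\<close> and variance \<open>1 / (N J)\<close> (Hubbard--Stratonovich). So the
  Fourier transform of the conditioned magnetization, multiplied by an explicit Gaussian factor, is
  the Fourier transform of \<open>y\<close> on the event that \<open>m\<^sub>N(\<sigma>)\<close> is in the window around \<open>\<mu>\<close>. Up to an exponentially
  small error relative to \<open>exp (N f(\<mu>))\<close> this event may be replaced by \<open>y\<close> being in a larger window on
  which \<open>f < f(\<mu>)\<close> away from \<open>\<mu>\<close>, and there Laplace's method applies at scale
  \<open>N\<close> to the power \<open>- 1 / (2 k)\<close>. The Gaussian factor
  survives in the limit only for \<open>k = 1\<close>, where it accounts for the correction \<open>- 1 / J\<close> to the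
  variance. Levy's continuity theorem concludes.\<close>

subsection \<open>Real analysis and Gaussian integrals\<close>

text \<open>The complex Taylor remainder bound restricted to real arguments. It controls the
  difference quotients of exponential moments.\<close>

lemma abs_exp_minus_linear: 
  fixes z :: real shows "\<bar>exp z - 1 - z\<bar> \<le> z\<^sup>2 * exp \<bar>z\<bar>"
proof -
  have "norm (exp (complex_of_real z) - (\<Sum>k\<le>1. complex_of_real z ^ k / fact k))
     \<le> exp \<bar>Re (complex_of_real z)\<bar> * norm (complex_of_real z) ^ Suc 1 / fact 1"
    by (rule Taylor_exp)
  also have "exp (complex_of_real z) - (\<Sum>k\<le>1. complex_of_real z ^ k / fact k) = of_real (exp z - 1 - z)"
    by (simp add: exp_of_real)
  finally show ?thesis by (simp add: power2_eq_square mult.commute del: of_real_diff)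
qed

text \<open>The substitution \<open>y = x / sqrt v\<close> turns the integrand into a multiple of
  the standard normal density, whose characteristic function is known. The parameter
  \<open>v\<close> is an inverse variance.\<close>

lemma gaussian_fourier:
  assumes v: "0 < v"
  shows "integrable lborel (\<lambda>y. exp (- (v * y\<^sup>2 / 2)))"
    and "(CLBINT y. iexp (t * y) * exp (- (v * y\<^sup>2 / 2))) = sqrt (2 * pi / v) * exp (- t\<^sup>2 / (2 * v))"
proof -
  have scale: "exp (- (v * (0 + 1 / sqrt v * x)\<^sup>2 / 2)) = sqrt (2 * pi) * std_normal_density x" for x
    using v by (simp add: std_normal_density_def power_mult_distrib power_divide)
  show "integrable lborel (\<lambda>y. exp (- (v * y\<^sup>2 / 2)))"
    using v by (subst lborel_integrable_real_affine_iff[symmetric, of "1 / sqrt v" _ 0])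
      (auto simp only: scale intro!: integrable_mult_right integrable_normal_density, simp)
  have "(CLBINT y. iexp (t * y) * exp (- (v * y\<^sup>2 / 2)))
      = \<bar>1 / sqrt v\<bar> *\<^sub>R (CLBINT x. iexp (t * (0 + 1 / sqrt v * x)) * exp (- (v * (0 + 1 / sqrt v * x)\<^sup>2 / 2)))"
    using v by (intro lborel_integral_real_affine) simp
  also have "\<dots> = \<bar>1 / sqrt v\<bar> *\<^sub>R (CLBINT x. of_real (sqrt (2 * pi)) * (std_normal_density x *\<^sub>R iexp (t / sqrt v * x)))"
    unfolding scale by (simp add: scaleR_conv_of_real mult_ac)
  also have "\<dots> = \<bar>1 / sqrt v\<bar> *\<^sub>R (of_real (sqrt (2 * pi)) * char std_normal_distribution (t / sqrt v))"
    unfolding char_def integral_mult_right_zero by (subst integral_density) simp_all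
  also have "\<dots> = sqrt (2 * pi / v) * exp (- t\<^sup>2 / (2 * v))"
    using v by (simp add: char_std_normal_distribution scaleR_conv_of_real real_sqrt_divide power_divide exp_of_real)
  finally show "(CLBINT y. iexp (t * y) * exp (- (v * y\<^sup>2 / 2))) = sqrt (2 * pi / v) * exp (- t\<^sup>2 / (2 * v))" .
qed

lemma gaussian_integral:
  assumes "0 < v"
  shows "(LBINT y. exp (- (v * y\<^sup>2 / 2))) = sqrt (2 * pi / v)"
proof -
  have "complex_of_real (LBINT y. exp (- (v * y\<^sup>2 / 2))) = (CLBINT y. iexp (0 * y) * exp (- (v * y\<^sup>2 / 2)))"
    by simp
  also have "\<dots> = complex_of_real (sqrt (2 * pi / v))"
    by (subst gaussian_fourier(2)[OF assms]) simp
  finally show ?thesis by (simp only: of_real_eq_iff)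
qed

text \<open>Translation by \<open>m\<close> reduces to the centred case. In the application
  \<open>m\<close> is the magnetization of a configuration, and the phase it produces is what
  survives the integration over \<open>y\<close>.\<close>

lemma gaussian_integral_shift:
  assumes "0 < v"
  shows "integrable lborel (\<lambda>y. exp (- (v * (y - m)\<^sup>2 / 2)))"
    and "(LBINT y. exp (- (v * (y - m)\<^sup>2 / 2))) = sqrt (2 * pi / v)"
    and "(CLBINT y. iexp (t * (y - \<mu>)) * exp (- (v * (y - m)\<^sup>2 / 2)))
      = iexp (t * (m - \<mu>)) * (sqrt (2 * pi / v) * exp (- t\<^sup>2 / (2 * v)))"
proof -
  show "integrable lborel (\<lambda>y. exp (- (v * (y - m)\<^sup>2 / 2)))"
    using gaussian_fourier(1)[OF assms] lborel_integrable_real_affine_iff[of 1 "\<lambda>y. exp (- (v * (y - m)\<^sup>2 / 2))" m]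
    by simp
  show "(LBINT y. exp (- (v * (y - m)\<^sup>2 / 2))) = sqrt (2 * pi / v)"
    using gaussian_integral[OF assms] lborel_integral_real_affine[of 1 "\<lambda>y. exp (- (v * (y - m)\<^sup>2 / 2))" m]
    by simp
  have eq: "iexp (t * (m + 1 * y - \<mu>)) = iexp (t * (m - \<mu>)) * iexp (t * y)" for y
    by (simp add: exp_add[symmetric] algebra_simps)
  have "(CLBINT y. iexp (t * (y - \<mu>)) * exp (- (v * (y - m)\<^sup>2 / 2)))
     = (CLBINT y. iexp (t * (m - \<mu>)) * (iexp (t * y) * exp (- (v * y\<^sup>2 / 2))))"
    unfolding lborel_integral_real_affine[of 1 "\<lambda>y. iexp (t * (y - \<mu>)) * exp (- (v * (y - m)\<^sup>2 / 2))" m,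
        OF one_neq_zero] eq
    by (simp add: mult.assoc)
  also have "\<dots> = iexp (t * (m - \<mu>)) * (sqrt (2 * pi / v) * exp (- t\<^sup>2 / (2 * v)))"
    by (simp only: integral_mult_right_zero gaussian_fourier(2)[OF assms])
  finally show "(CLBINT y. iexp (t * (y - \<mu>)) * exp (- (v * (y - m)\<^sup>2 / 2)))
      = iexp (t * (m - \<mu>)) * (sqrt (2 * pi / v) * exp (- t\<^sup>2 / (2 * v)))" .
qed

text \<open>Since \<open>x ^ (2 * k)\<close> is at least \<open>x\<^sup>2 - 1\<close>, a Gaussian
  times \<open>exp c\<close> dominates.\<close>

lemma integrable_exp_even_power:
  fixes c :: real
  assumes c: "0 < c" and k: "1 \<le> k"
  shows "integrable lborel (\<lambda>x. exp (- (c * x ^ (2 * k))))"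
proof (rule Bochner_Integration.integrable_bound)
  show "integrable lborel (\<lambda>x. exp c * exp (- (2 * c * x\<^sup>2 / 2)))"
    using c by (intro integrable_mult_right gaussian_fourier(1)) simp
  show "AE x in lborel. norm (exp (- (c * x ^ (2 * k)))) \<le> norm (exp c * exp (- (2 * c * x\<^sup>2 / 2)))"
  proof (intro AE_I2)
    fix x :: real
    have "x\<^sup>2 - 1 \<le> (x\<^sup>2) ^ k"
    proof (cases "1 \<le> x\<^sup>2")
      case True
      then show ?thesis using power_increasing[OF k True] by simp
    next
      case False
      moreover have "0 \<le> (x\<^sup>2) ^ k" by simp
      ultimately show ?thesis by linarith
    qed
    then have "c * (x\<^sup>2 - 1) \<le> c * x ^ (2 * k)"
      using c by (simp add: power_mult)
    then show "norm (exp (- (c * x ^ (2 * k)))) \<le> norm (exp c * exp (- (2 * c * x\<^sup>2 / 2)))"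
      by (simp add: exp_add[symmetric] algebra_simps)
  qed
qed measurable

text \<open>Finitely many initial terms do not matter. This allows Levy's theorem to be applied only
  from the index on which the conditional laws are probability measures.\<close>

lemma weak_conv_m_offset:
  assumes "weak_conv_m (\<lambda>n. M (n + n0)) M'"
  shows "weak_conv_m M M'"
  using assms unfolding weak_conv_m_def weak_conv_def by (blast intro: LIMSEQ_offset)

text \<open>This is the fluctuation scale: with \<open>b = N powr (1 / (2 * k))\<close>, the
  substitution \<open>y - \<mu> = x / b\<close> turns \<open>N * (y - \<mu>) ^ (2 * k)\<close> into
  \<open>x ^ (2 * k)\<close>.\<close>

lemma powr_scale:
  assumes k: "1 \<le> k"
  shows "(real (Suc n) powr (1 / (2 * real k))) ^ (2 * k) = real (Suc n)"
    and "filterlim (\<lambda>n. real (Suc n) powr (1 / (2 * real k))) at_top sequentially"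
proof -
  have "(real (Suc n) powr (1 / (2 * real k))) ^ (2 * k) = (real (Suc n) powr (1 / (2 * real k))) powr real (2 * k)"
    by (intro powr_realpow[symmetric]) simp
  then show "(real (Suc n) powr (1 / (2 * real k))) ^ (2 * k) = real (Suc n)"
    using k by (simp add: powr_powr)
  have "0 < 1 / (2 * real k)" using k by simp
  then show "filterlim (\<lambda>n. real (Suc n) powr (1 / (2 * real k))) at_top sequentially"
    by real_asymp
qed

lemma even_power_density_pos:
  fixes lam :: real
  assumes lam: "lam < 0" and k: "1 \<le> k"
  shows "integrable lborel (\<lambda>x. exp (lam / fact (2 * k) * x ^ (2 * k)))" (is ?int)
    and "0 < (LBINT x. exp (lam / fact (2 * k) * x ^ (2 * k)))"
proof -
  show ?int
    using integrable_exp_even_power[of "- lam / fact (2 * k)" k] lam k by (simp add: divide_neg_pos)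
  then have "(LBINT x. exp (lam / fact (2 * k) * x ^ (2 * k))) \<noteq> 0"
    by (subst integral_nonneg_eq_0_iff_AE) (auto simp: eventually_const_iff ae_filter_eq_bot_iff)
  moreover have "0 \<le> (LBINT x. exp (lam / fact (2 * k) * x ^ (2 * k)))" by simp
  ultimately show "0 < (LBINT x. exp (lam / fact (2 * k) * x ^ (2 * k)))" by linarith
qed

lemma char_normal_density:
  assumes s: "0 < s"
  shows "char (density lborel (normal_density 0 s)) t = exp (- (s * t)\<^sup>2 / 2)"
proof -
  have v: "0 < 1 / s\<^sup>2" using s by simp
  have "char (density lborel (normal_density 0 s)) t = (CLBINT x. normal_density 0 s x *\<^sub>R iexp (t * x))"
    unfolding char_def by (intro integral_density) auto
  also have "\<dots> = (CLBINT x. of_real (1 / sqrt (2 * pi * s\<^sup>2)) * (iexp (t * x) * exp (- (1 / s\<^sup>2 * x\<^sup>2 / 2))))"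
    by (simp add: normal_density_def scaleR_conv_of_real mult_ac)
  also have "\<dots> = of_real (1 / sqrt (2 * pi * s\<^sup>2)) * of_real (sqrt (2 * pi / (1 / s\<^sup>2)) * exp (- t\<^sup>2 / (2 * (1 / s\<^sup>2))))"
    unfolding integral_mult_right_zero gaussian_fourier(2)[OF v] ..
  also have "\<dots> = exp (- (s * t)\<^sup>2 / 2)"
    unfolding of_real_mult[symmetric] using s by (simp add: power_mult_distrib mult.commute)
  finally show ?thesis .
qed

subsection \<open>Smoothness of the free energy functional\<close>

locale curie_weiss = prob_space \<rho> for \<rho> :: "real measure" +
  fixes J h :: real
  assumes sets_rho [measurable_cong]: "sets \<rho> = sets borel"
    and integrable_exp_square: "0 < a \<Longrightarrow> integrable \<rho> (\<lambda>x. exp (a * x\<^sup>2 / 2 + b * x))"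
    and J_pos: "0 < J"
begin

text \<open>The power is absorbed by
  \<open>\<bar>s\<bar> ^ n \<le> fact n * exp \<bar>s\<bar>\<close>, and the resulting linear growth
  in \<open>\<bar>s\<bar>\<close> by completing a square. What remains is the integrability
  hypothesis with \<open>a = 1\<close>.\<close>

lemma integrable_power_exp_abs:
  "integrable \<rho> (\<lambda>s. \<bar>s\<bar> ^ n * exp (t * s + c * \<bar>s\<bar>))"
proof (rule Bochner_Integration.integrable_bound)
  show "integrable \<rho> (\<lambda>s. fact n * exp ((1 + c)\<^sup>2 / 2) * exp (1 * s\<^sup>2 / 2 + t * s))"
    by (intro integrable_mult_right integrable_exp_square) simp
  show "AE s in \<rho>. norm (\<bar>s\<bar> ^ n * exp (t * s + c * \<bar>s\<bar>))
          \<le> norm (fact n * exp ((1 + c)\<^sup>2 / 2) * exp (1 * s\<^sup>2 / 2 + t * s))"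
  proof (intro AE_I2)
    fix s :: real
    \<comment> \<open>A single term of the exponential series is at most the whole sum.\<close>
    have "\<bar>s\<bar> ^ n / fact n \<le> (\<Sum>i\<in>{n}. \<bar>s\<bar> ^ i /\<^sub>R fact i)"
      by (simp add: field_simps)
    also have "\<dots> \<le> exp \<bar>s\<bar>"
      unfolding exp_def by (intro sum_le_suminf summable_exp_generic) auto
    finally have "\<bar>s\<bar> ^ n \<le> fact n * exp \<bar>s\<bar>"
      by (simp add: field_simps)
    then have "\<bar>s\<bar> ^ n * exp (t * s + c * \<bar>s\<bar>) \<le> fact n * exp \<bar>s\<bar> * exp (t * s + c * \<bar>s\<bar>)"
      by (intro mult_right_mono) auto
    also have "\<dots> = fact n * exp ((1 + c) * \<bar>s\<bar> + t * s)"
      by (simp add: exp_add[symmetric] algebra_simps)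
    also have "(1 + c) * \<bar>s\<bar> \<le> (1 + c)\<^sup>2 / 2 + s\<^sup>2 / 2"
      using zero_le_power2[of "1 + c - \<bar>s\<bar>"]
      by (simp add: power2_eq_square field_simps)
    then have "fact n * exp ((1 + c) * \<bar>s\<bar> + t * s) \<le> fact n * exp ((1 + c)\<^sup>2 / 2 + s\<^sup>2 / 2 + t * s)"
      by simp
    also have "\<dots> = fact n * exp ((1 + c)\<^sup>2 / 2) * exp (1 * s\<^sup>2 / 2 + t * s)"
      by (simp add: exp_add)
    finally show "norm (\<bar>s\<bar> ^ n * exp (t * s + c * \<bar>s\<bar>))
          \<le> norm (fact n * exp ((1 + c)\<^sup>2 / 2) * exp (1 * s\<^sup>2 / 2 + t * s))"
      by (simp add: abs_mult)
  qed
qed measurable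

text \<open>\<open>moment 0\<close> is the moment generating function of \<rho>; the quotients
  \<open>moment n t / moment 0 t\<close> are the moments of the exponentially tilted law.\<close>

definition moment :: "nat \<Rightarrow> real \<Rightarrow> real" where
  "moment n t = (\<integral>s. s ^ n * exp (t * s) \<partial>\<rho>)"

lemma integrable_moment: "integrable \<rho> (\<lambda>s. s ^ n * exp (t * s))"
  by (rule Bochner_Integration.integrable_bound[OF integrable_power_exp_abs[of n t 0]])
     (auto simp: abs_mult power_abs)

text \<open>Differentiation under the integral: the pointwise Taylor bound leaves an error of
  \<open>\<bar>u\<bar>\<close> times a fixed integrable function.\<close>

lemma DERIV_moment: "(moment n has_field_derivative moment (Suc n) t) (at t)"
  unfolding DERIV_def
proof (rule LIM_zero_cancel, rule Lim_null_comparison)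
  \<comment> \<open>The factor \<open>exp \<bar>s\<bar>\<close> in the integrand dominates
    \<open>exp \<bar>u * s\<bar>\<close> for all \<open>\<bar>u\<bar> \<le> 1\<close>, so
    \<open>C\<close> does not depend on \<open>u\<close>.\<close>
  define C where "C = (\<integral>s. \<bar>s\<bar> ^ (n + 2) * exp (t * s + 1 * \<bar>s\<bar>) \<partial>\<rho>)"
  show "((\<lambda>u. \<bar>u\<bar> * C) \<longlongrightarrow> 0) (at 0)"
    by (auto intro!: tendsto_eq_intros)
  show "\<forall>\<^sub>F u in at 0. norm ((moment n (t + u) - moment n t) / u - moment (Suc n) t) \<le> \<bar>u\<bar> * C"
    unfolding eventually_at
  proof (intro exI[of _ 1] conjI ballI impI)
    fix u :: real assume "u \<noteq> 0 \<and> dist u 0 < 1"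
    then have u: "u \<noteq> 0" "\<bar>u\<bar> \<le> 1" by auto
    have eq: "(moment n (t + u) - moment n t) / u - moment (Suc n) t
      = (\<integral>s. (s ^ n * exp ((t + u) * s) - s ^ n * exp (t * s)) / u - s ^ Suc n * exp (t * s) \<partial>\<rho>)"
      unfolding moment_def
      by (simp add: integrable_moment del: power_Suc)
    have "norm ((moment n (t + u) - moment n t) / u - moment (Suc n) t) \<le> (\<integral>s. \<bar>u\<bar> * (\<bar>s\<bar> ^ (n + 2) * exp (t * s + 1 * \<bar>s\<bar>)) \<partial>\<rho>)"
      unfolding eq
    proof (rule Bochner_Integration.integral_norm_bound_integral)
      show "integrable \<rho> (\<lambda>s. (s ^ n * exp ((t + u) * s) - s ^ n * exp (t * s)) / u - s ^ Suc n * exp (t * s))"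
        by (intro Bochner_Integration.integrable_diff integrable_divide integrable_moment)
      show "integrable \<rho> (\<lambda>s. \<bar>u\<bar> * (\<bar>s\<bar> ^ (n + 2) * exp (t * s + 1 * \<bar>s\<bar>)))"
        by (intro integrable_mult_right integrable_power_exp_abs)
      fix s :: real
      have eq: "(s ^ n * exp ((t + u) * s) - s ^ n * exp (t * s)) / u - s ^ Suc n * exp (t * s)
        = s ^ n * exp (t * s) * (exp (u * s) - 1 - u * s) / u"
        using u(1) by (simp add: field_simps exp_add)
      have "norm ((s ^ n * exp ((t + u) * s) - s ^ n * exp (t * s)) / u - s ^ Suc n * exp (t * s))
        = \<bar>s\<bar> ^ n * exp (t * s) * \<bar>exp (u * s) - 1 - u * s\<bar> / \<bar>u\<bar>"
        unfolding eq by (simp add: abs_mult power_abs)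
      also have "\<dots> \<le> \<bar>s\<bar> ^ n * exp (t * s) * ((u * s)\<^sup>2 * exp \<bar>s\<bar>) / \<bar>u\<bar>"
      proof (intro divide_right_mono mult_left_mono)
        have "\<bar>u * s\<bar> \<le> \<bar>s\<bar>"
          using u by (simp add: abs_mult mult_left_le_one_le)
        then have "(u * s)\<^sup>2 * exp \<bar>u * s\<bar> \<le> (u * s)\<^sup>2 * exp \<bar>s\<bar>"
          by (intro mult_left_mono) auto
        then show "\<bar>exp (u * s) - 1 - u * s\<bar> \<le> (u * s)\<^sup>2 * exp \<bar>s\<bar>"
          using abs_exp_minus_linear[of "u * s"] by linarith
      qed auto
      also have "\<dots> = \<bar>u\<bar> * (\<bar>s\<bar> ^ (n + 2) * exp (t * s + 1 * \<bar>s\<bar>))"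
      proof -
        have "(u * s)\<^sup>2 / \<bar>u\<bar> = \<bar>u\<bar> * \<bar>s\<bar>\<^sup>2"
          using u(1) by (simp add: power2_eq_square divide_simps)
        moreover have "\<bar>s\<bar> ^ n * exp (t * s) * ((u * s)\<^sup>2 * exp \<bar>s\<bar>) / \<bar>u\<bar>
           = \<bar>s\<bar> ^ n * exp (t * s) * ((u * s)\<^sup>2 / \<bar>u\<bar> * exp \<bar>s\<bar>)"
          by simp
        ultimately have "\<bar>s\<bar> ^ n * exp (t * s) * ((u * s)\<^sup>2 * exp \<bar>s\<bar>) / \<bar>u\<bar>
           = \<bar>s\<bar> ^ n * exp (t * s) * (\<bar>u\<bar> * \<bar>s\<bar>\<^sup>2 * exp \<bar>s\<bar>)"
          by (simp only:)
        then show ?thesis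
          by (simp add: exp_add power_add power2_eq_square ac_simps)
      qed
      finally show "norm ((s ^ n * exp ((t + u) * s) - s ^ n * exp (t * s)) / u - s ^ Suc n * exp (t * s))
         \<le> \<bar>u\<bar> * (\<bar>s\<bar> ^ (n + 2) * exp (t * s + 1 * \<bar>s\<bar>))" .
    qed
    also have "\<dots> = \<bar>u\<bar> * C"
      unfolding C_def by (rule integral_mult_right_zero)
    finally show "norm ((moment n (t + u) - moment n t) / u - moment (Suc n) t) \<le> \<bar>u\<bar> * C" .
  qed simp
qed

lemma moment_0_pos: "0 < moment 0 t"
proof -
  have "moment 0 t \<noteq> 0"
  proof
    assume "moment 0 t = 0"
    then have "AE s in \<rho>. s ^ 0 * exp (t * s) = 0"
      unfolding moment_def
      by (subst (asm) integral_nonneg_eq_0_iff_AE[OF integrable_moment]) auto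
    then show False by simp
  qed
  moreover have "0 \<le> moment 0 t"
    unfolding moment_def by simp
  ultimately show ?thesis by simp
qed

text \<open>The derivative of \<open>f_CW\<close> lies in this algebra, which is closed under differentiation; hence
  the iterated \<open>deriv\<close> of \<open>f_CW\<close> are genuine derivatives.\<close>

inductive derivative_closed :: "(real \<Rightarrow> real) \<Rightarrow> bool" where
  const: "derivative_closed (\<lambda>x. c)"
| ident: "derivative_closed (\<lambda>x. x)"
| moment: "derivative_closed (\<lambda>x. moment n (J * x + h))"
| inverse: "derivative_closed (\<lambda>x. inverse (moment 0 (J * x + h)))"
| add: "derivative_closed f \<Longrightarrow> derivative_closed g \<Longrightarrow> derivative_closed (\<lambda>x. f x + g x)"
| mult: "derivative_closed f \<Longrightarrow> derivative_closed g \<Longrightarrow> derivative_closed (\<lambda>x. f x * g x)"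

lemmas DERIV_moment_chain [derivative_intros] = DERIV_chain2[OF DERIV_moment]

lemma DERIV_moment_affine:
  "((\<lambda>x. moment n (J * x + h)) has_field_derivative J * moment (Suc n) (J * x + h)) (at x)"
  by (auto intro!: derivative_eq_intros)

text \<open>Induction over the generators. Differentiating the reciprocal gives a product of
  generators, so no further kind of quotient has to be adjoined.\<close>

lemma derivative_closed_DERIV:
  assumes "derivative_closed f"
  shows "\<exists>f'. derivative_closed f' \<and> (\<forall>x. (f has_field_derivative f' x) (at x))"
  using assms
proof induction
  case (const c)
  show ?case by (intro exI[of _ "\<lambda>x. 0"] conjI derivative_closed.const) auto
next
  case ident
  show ?case by (intro exI[of _ "\<lambda>x. 1"] conjI derivative_closed.const) auto
next
  case (moment n)
  show ?case
    by (intro exI[of _ "\<lambda>x. J * moment (Suc n) (J * x + h)"] conjI derivative_closed.intros)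
       (auto intro: DERIV_moment_affine)
next
  case inverse
  show ?case
    using moment_0_pos
    by (intro exI[of _ "\<lambda>x. (- J) * (inverse (moment 0 (J * x + h)) * moment (Suc 0) (J * x + h) *
          inverse (moment 0 (J * x + h)))"] conjI derivative_closed.intros allI)
       (auto intro!: derivative_eq_intros simp: less_imp_neq[symmetric])
next
  case (add f g)
  then obtain f' g' where "derivative_closed f'" "derivative_closed g'"
    "\<And>x. (f has_field_derivative f' x) (at x)" "\<And>x. (g has_field_derivative g' x) (at x)" by auto
  then show ?case
    by (intro exI[of _ "\<lambda>x. f' x + g' x"] conjI derivative_closed.intros)
       (auto intro!: derivative_eq_intros)
next
  case (mult f g)
  then obtain f' g' where "derivative_closed f'" "derivative_closed g'"
    "\<And>x. (f has_field_derivative f' x) (at x)" "\<And>x. (g has_field_derivative g' x) (at x)" by auto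
  with mult show ?case
    by (intro exI[of _ "\<lambda>x. f x * g' x + f' x * g x"] conjI derivative_closed.intros)
       (auto intro!: derivative_eq_intros)
qed

lemma derivative_closed_deriv:
  assumes "derivative_closed f"
  shows "derivative_closed (deriv f)" "(f has_field_derivative deriv f x) (at x)"
proof -
  obtain f' where f': "derivative_closed f'" "\<And>x. (f has_field_derivative f' x) (at x)"
    using derivative_closed_DERIV[OF assms] by auto
  then have "deriv f = f'"
    by (auto simp: DERIV_imp_deriv)
  with f' show "derivative_closed (deriv f)" "(f has_field_derivative deriv f x) (at x)"
    by auto
qed

section \<open>Derivatives of \<open>f\<close> and its expansion at a maximum point\<close>

abbreviation f where "f \<equiv> f_CW \<rho> J h"

lemma f_eq: "f x = - (J / 2) * x\<^sup>2 + ln (moment 0 (J * x + h))"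
  by (simp add: f_CW_def moment_def mult.commute)

lemma DERIV_f:
  "(f has_field_derivative - J * x + J * (moment 1 (J * x + h) / moment 0 (J * x + h))) (at x)"
  unfolding f_eq[abs_def] using moment_0_pos[of "J * x + h"]
  by (auto intro!: derivative_eq_intros simp: power2_eq_square)

text \<open>The algebra has no constructor for the logarithm in \<open>f\<close>, so
  \<open>j = 0\<close> is settled by \<open>DERIV_f\<close>; from \<open>deriv f\<close> on, all
  iterates stay in the algebra.\<close>

lemma DERIV_higher_deriv_f:
  "((deriv ^^ j) f has_field_derivative (deriv ^^ Suc j) f x) (at x)"
proof (cases j)
  case 0
  then show ?thesis using DERIV_f[of x]
    by (simp only: DERIV_imp_deriv[OF DERIV_f] funpow.simps id_apply o_apply)
next
  case (Suc i)
  have "derivative_closed (deriv f)"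
  proof -
    have "deriv f = (\<lambda>x. (- J) * x + J * (moment 1 (J * x + h) * inverse (moment 0 (J * x + h))))"
      using DERIV_f by (auto simp: DERIV_imp_deriv divide_inverse)
    then show ?thesis by (simp only: derivative_closed.intros)
  qed
  then have "derivative_closed ((deriv ^^ i) (deriv f))" for i
    by (induction i) (auto intro: derivative_closed_deriv)
  from derivative_closed_deriv(2)[OF this, of i x] show ?thesis
    by (simp add: Suc funpow_swap1)
qed

text \<open>Up to the factor \<open>(moment 0 t)\<^sup>2\<close> this is the variance of the tilted
  law. If it vanished, \<rho> would be concentrated at one point.\<close>

lemma variance_pos:
  assumes "\<And>c. \<rho> \<noteq> return borel c"
  shows "0 < moment 2 t * moment 0 t - (moment 1 t)\<^sup>2"
proof -
  \<comment> \<open>The mean of the tilted law.\<close>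
  define c where "c = moment 1 t / moment 0 t"
  note int [simp] = integrable_moment[of 0 t, simplified] integrable_moment[of 1 t, simplified] integrable_moment[of 2 t, simplified]
  have eq: "(s - c)\<^sup>2 * exp (t * s) = s\<^sup>2 * exp (t * s) - 2 * c * (s * exp (t * s)) + c\<^sup>2 * exp (t * s)" for s
    by (simp add: power2_eq_square algebra_simps)
  have int2: "integrable \<rho> (\<lambda>s. (s - c)\<^sup>2 * exp (t * s))"
    unfolding eq by simp
  have "(\<integral>s. (s - c)\<^sup>2 * exp (t * s) \<partial>\<rho>) = moment 2 t - 2 * c * moment 1 t + c\<^sup>2 * moment 0 t"
    unfolding eq moment_def by (simp)
  also have "\<dots> = (moment 2 t * moment 0 t - (moment 1 t)\<^sup>2) / moment 0 t"
    unfolding c_def using moment_0_pos[of t] by (simp add: field_simps power2_eq_square)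
  finally have *: "(\<integral>s. (s - c)\<^sup>2 * exp (t * s) \<partial>\<rho>) = (moment 2 t * moment 0 t - (moment 1 t)\<^sup>2) / moment 0 t" .
  have "(\<integral>s. (s - c)\<^sup>2 * exp (t * s) \<partial>\<rho>) \<noteq> 0"
  proof
    assume "(\<integral>s. (s - c)\<^sup>2 * exp (t * s) \<partial>\<rho>) = 0"
    then have "AE s in \<rho>. (s - c)\<^sup>2 * exp (t * s) = 0"
      by (subst (asm) integral_nonneg_eq_0_iff_AE[OF int2]) auto
    then have "AE s in \<rho>. s = c" by simp
    from AE_eq_constD[OF this] have "\<rho> = return borel c"
      using sets_rho by (metis return_sets_cong)
    with assms show False by blast
  qed
  moreover have "0 \<le> (\<integral>s. (s - c)\<^sup>2 * exp (t * s) \<partial>\<rho>)" by simp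
  ultimately have "0 < (moment 2 t * moment 0 t - (moment 1 t)\<^sup>2) / moment 0 t"
    unfolding * by linarith
  then show ?thesis using moment_0_pos[of t] by (simp add: zero_less_divide_iff)
qed

text \<open>The second derivative is \<open>- J\<close> plus \<open>J\<^sup>2\<close> times the
  variance of the law tilted by \<open>J * x + h\<close>. For type 1 this gives
  \<open>- J < lam\<close>, hence the positivity of the limiting variance.\<close>

lemma second_deriv_f_gt:
  assumes "\<And>c. \<rho> \<noteq> return borel c"
  shows "- J < (deriv ^^ 2) f x"
proof -
  define t where "t = J * x + h"
  have "deriv f = (\<lambda>x. - J * x + J * (moment 1 (J * x + h) / moment 0 (J * x + h)))"
    using DERIV_f by (auto simp: DERIV_imp_deriv)
  moreover have "((\<lambda>x. - J * x + J * (moment 1 (J * x + h) / moment 0 (J * x + h))) has_field_derivative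
     - J + J * (J * ((moment 2 t * moment 0 t - (moment 1 t)\<^sup>2) / (moment 0 t)\<^sup>2))) (at x)"
    unfolding t_def using moment_0_pos[of "J * x + h"]
    by (auto intro!: derivative_eq_intros simp: power2_eq_square numeral_2_eq_2 algebra_simps)
  ultimately have "(deriv ^^ 2) f x = - J + J * (J * ((moment 2 t * moment 0 t - (moment 1 t)\<^sup>2) / (moment 0 t)\<^sup>2))"
    by (simp add: numeral_2_eq_2 DERIV_imp_deriv)
  then show ?thesis
    using variance_pos[OF assms, of t] moment_0_pos[of t] J_pos by simp
qed

text \<open>The function \<open>g\<close> is the derivative of order \<open>2 * k\<close> at the
  Lagrange intermediate point. That point is squeezed towards \<mu>, so continuity of the derivative
  yields the limit \<open>lam\<close>.\<close>

lemma Taylor_at_maximum: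
  assumes type: "has_type_strength f \<mu> k lam"
  obtains g where "\<And>x. f x = f \<mu> + g x / fact (2 * k) * (x - \<mu>) ^ (2 * k)"
    and "(g \<longlongrightarrow> lam) (at \<mu>)" and "g \<mu> = lam"
proof -
  let ?D = "\<lambda>j. (deriv ^^ j) f"
  have k: "1 \<le> k" and zero: "\<And>j. 1 \<le> j \<Longrightarrow> j < 2 * k \<Longrightarrow> ?D j \<mu> = 0" and lam: "?D (2 * k) \<mu> = lam"
    using type by (auto simp: has_type_strength_def)
  have "\<exists>t. \<bar>t - \<mu>\<bar> \<le> \<bar>x - \<mu>\<bar> \<and> f x = f \<mu> + ?D (2 * k) t / fact (2 * k) * (x - \<mu>) ^ (2 * k)" for x
  proof (cases "x = \<mu>")
    case True
    with k show ?thesis by (intro exI[of _ \<mu>]) auto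
  next
    case False
    have "\<exists>t. (if x < \<mu> then x < t \<and> t < \<mu> else \<mu> < t \<and> t < x) \<and>
        f x = (\<Sum>m<2 * k. ?D m \<mu> / fact m * (x - \<mu>) ^ m) + ?D (2 * k) t / fact (2 * k) * (x - \<mu>) ^ (2 * k)"
      using k False DERIV_higher_deriv_f
      by (intro Taylor[where a = "min x \<mu>" and b = "max x \<mu>"]) auto
    moreover have "(\<Sum>m<2 * k. ?D m \<mu> / fact m * (x - \<mu>) ^ m) = f \<mu>"
    proof -
      have "(\<Sum>m<2 * k. ?D m \<mu> / fact m * (x - \<mu>) ^ m) = (\<Sum>m\<in>{0}. ?D m \<mu> / fact m * (x - \<mu>) ^ m)"
        using k zero by (intro sum.mono_neutral_right) auto
      then show ?thesis by simp
    qed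
    ultimately show ?thesis by (force split: if_splits)
  qed
  then obtain \<tau> where \<tau>: "\<And>x. \<bar>\<tau> x - \<mu>\<bar> \<le> \<bar>x - \<mu>\<bar>"
    "\<And>x. f x = f \<mu> + ?D (2 * k) (\<tau> x) / fact (2 * k) * (x - \<mu>) ^ (2 * k)"
    by metis
  have "(\<tau> \<longlongrightarrow> \<mu>) (at \<mu>)"
  proof (rule LIM_zero_cancel, rule Lim_null_comparison)
    show "((\<lambda>x. \<bar>x - \<mu>\<bar>) \<longlongrightarrow> 0) (at \<mu>)" by (auto intro!: tendsto_eq_intros)
  qed (use \<tau>(1) in auto)
  moreover have "isCont (?D (2 * k)) \<mu>"
    using DERIV_higher_deriv_f DERIV_isCont by blast
  ultimately have "((\<lambda>x. ?D (2 * k) (\<tau> x)) \<longlongrightarrow> lam) (at \<mu>)"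
    using isCont_tendsto_compose lam by blast
  moreover have "\<tau> \<mu> = \<mu>"
    using \<tau>(1)[of \<mu>] by simp
  then have "?D (2 * k) (\<tau> \<mu>) = lam"
    using lam by simp
  ultimately show thesis
    by (rule that[OF \<tau>(2)])
qed

subsection \<open>The Gaussian coupling\<close>

abbreviation configurations :: "nat \<Rightarrow> (nat \<Rightarrow> real) measure" where
  "configurations N \<equiv> PiM {..<N} (\<lambda>_. \<rho>)"

definition boltzmann :: "nat \<Rightarrow> (nat \<Rightarrow> real) \<Rightarrow> real" where
  "boltzmann N \<sigma> = exp (- H_N J h N \<sigma>)"

text \<open>The exponent is linear in \<open>S_N\<close>, so for fixed \<open>y\<close> the weight
  is a product over the sites, in contrast to the Boltzmann factor with its quadratic
  exponent.\<close>

definition kernel :: "nat \<Rightarrow> (nat \<Rightarrow> real) \<Rightarrow> real \<Rightarrow> real" where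
  "kernel N \<sigma> y = exp (- (real N * J * y\<^sup>2 / 2) + (J * y + h) * S_N N \<sigma>)"

lemma measurable_S_N [measurable]: "S_N N \<in> borel_measurable (configurations N)"
  unfolding S_N_def[abs_def] by measurable

lemma measurable_m_N [measurable]: "m_N N \<in> borel_measurable (configurations N)"
  unfolding m_N_def[abs_def] by measurable

lemma H_N_eq: "H_N J h N \<sigma> = - (J / (2 * real N)) * (S_N N \<sigma>)\<^sup>2 - h * S_N N \<sigma>"
  unfolding H_N_def S_N_def by (simp add: sum_product power2_eq_square)

lemma measurable_boltzmann [measurable]: "boltzmann N \<in> borel_measurable (configurations N)"
  unfolding boltzmann_def[abs_def] H_N_eq by measurable

text \<open>Completing the square in \<open>y\<close> leaves exactly the quadratic interaction term
  of \<open>H_N\<close>.\<close>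

lemma kernel_eq:
  assumes "0 < N"
  shows "kernel N \<sigma> y = boltzmann N \<sigma> * exp (- ((real N * J) * (y - m_N N \<sigma>)\<^sup>2 / 2))"
  unfolding kernel_def boltzmann_def H_N_eq m_N_def using assms
  by (simp add: exp_add[symmetric] power2_eq_square field_simps)

lemma boltzmann_pos: "0 < boltzmann N \<sigma>"
  by (simp add: boltzmann_def)

lemma kernel_nonneg: "0 \<le> kernel N \<sigma> y"
  by (simp add: kernel_def)

lemma prob_space_configurations: "prob_space (configurations N)"
  by (intro prob_space_PiM prob_space_axioms)

lemma product_sigma_finite_rho: "product_sigma_finite (\<lambda>_::nat. \<rho>)"
  by (simp add: product_sigma_finite_def sigma_finite_measure_axioms)

lemma pair_sigma_finite_configurations: "pair_sigma_finite (configurations N) lborel"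
proof -
  interpret R: prob_space "configurations N" by (rule prob_space_configurations)
  show ?thesis by standard
qed

text \<open>By Cauchy-Schwarz the square of \<open>S_N\<close> is at most \<open>N\<close> times the
  sum of the squared spins. The weight is thus dominated by a product of one-site functions,
  integrable by hypothesis with \<open>a = J\<close>.\<close>

lemma integrable_boltzmann: "integrable (configurations N) (boltzmann N)"
proof (rule Bochner_Integration.integrable_bound)
  show "integrable (configurations N) (\<lambda>\<sigma>. \<Prod>i<N. exp (J * (\<sigma> i)\<^sup>2 / 2 + h * \<sigma> i))"
    using J_pos
    by (intro product_sigma_finite.product_integrable_prod[OF product_sigma_finite_rho] integrable_exp_square) auto
  show "AE \<sigma> in configurations N. norm (boltzmann N \<sigma>) \<le> norm (\<Prod>i<N. exp (J * (\<sigma> i)\<^sup>2 / 2 + h * \<sigma> i))"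
  proof (intro AE_I2)
    fix \<sigma> :: "nat \<Rightarrow> real"
    have "(S_N N \<sigma>)\<^sup>2 \<le> (\<Sum>i<N. (\<sigma> i)\<^sup>2) * real N"
      unfolding S_N_def using sum_squared_le_sum_of_squares[of \<sigma> "{..<N}"] by (simp add: mult.commute)
    then have "(S_N N \<sigma>)\<^sup>2 / real N \<le> (\<Sum>i<N. (\<sigma> i)\<^sup>2)"
      \<comment> \<open>For \<open>N = 0\<close> both sides are zero, since division by zero yields
        zero.\<close>
      by (cases "N = 0") (auto simp: divide_simps S_N_def)
    then have "J / 2 * ((S_N N \<sigma>)\<^sup>2 / real N) \<le> J / 2 * (\<Sum>i<N. (\<sigma> i)\<^sup>2)"
      using J_pos by (intro mult_left_mono) auto
    then have "- H_N J h N \<sigma> \<le> (\<Sum>i<N. J * (\<sigma> i)\<^sup>2 / 2 + h * \<sigma> i)"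
      unfolding H_N_eq S_N_def by (simp add: sum.distrib sum_distrib_left sum_divide_distrib)
    then show "norm (boltzmann N \<sigma>) \<le> norm (\<Prod>i<N. exp (J * (\<sigma> i)\<^sup>2 / 2 + h * \<sigma> i))"
      by (simp add: boltzmann_def exp_sum[symmetric] abs_prod)
  qed
qed measurable

lemma Z_N_eq: "Z_N \<rho> J h N = (\<integral>\<sigma>. boltzmann N \<sigma> \<partial>configurations N)"
  by (simp add: Z_N_def boltzmann_def)

lemma Z_N_pos: "0 < Z_N \<rho> J h N"
proof -
  interpret R: prob_space "configurations N" by (rule prob_space_configurations)
  have "(\<integral>\<sigma>. 0 \<partial>configurations N) < (\<integral>\<sigma>. boltzmann N \<sigma> \<partial>configurations N)"
    using boltzmann_pos R.emeasure_space_1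
    by (intro R.integral_less_AE_space integrable_boltzmann) auto
  then show ?thesis by (simp add: Z_N_eq)
qed

text \<open>For fixed \<open>y\<close> independence of the spins gives the \<open>N\<close>-th power
  of the moment generating function at \<open>J * y + h\<close>.\<close>

lemma integral_kernel_configurations:
  "(\<integral>\<sigma>. kernel N \<sigma> y \<partial>configurations N) = exp (real N * f y)"
proof -
  have int: "integrable \<rho> (\<lambda>s. exp ((J * y + h) * s))"
    using integrable_moment[of 0] by simp
  have "(\<integral>\<sigma>. kernel N \<sigma> y \<partial>configurations N)
     = (\<integral>\<sigma>. exp (- (real N * J * y\<^sup>2 / 2)) * (\<Prod>i<N. exp ((J * y + h) * \<sigma> i)) \<partial>configurations N)"
    unfolding kernel_def exp_add S_N_def sum_distrib_left by (simp add: exp_sum)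
  also have "\<dots> = exp (- (real N * J * y\<^sup>2 / 2)) * (\<Prod>i<N. \<integral>s. exp ((J * y + h) * s) \<partial>\<rho>)"
    using int
    by (subst product_sigma_finite.product_integral_prod[OF product_sigma_finite_rho, symmetric]) auto
  also have "\<dots> = exp (- (real N * J * y\<^sup>2 / 2)) * moment 0 (J * y + h) ^ N"
    by (simp add: moment_def)
  also have "\<dots> = exp (real N * f y)"
  proof -
    have "moment 0 (J * y + h) ^ N = exp (real N * ln (moment 0 (J * y + h)))"
      using moment_0_pos[of "J * y + h"] by (simp add: exp_of_nat_mult)
    then show ?thesis
      unfolding f_eq by (simp add: exp_add[symmetric] algebra_simps)
  qed
  finally show ?thesis .
qed

text \<open>The inverse variance \<open>v\<close> is left free because two values occur:
  \<open>N * J\<close>, which gives \<open>kernel\<close>, and \<open>N * J / 2\<close>, when half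
  of the exponent has been spent on a tail bound.\<close>

lemma boltzmann_gaussian:
  assumes v: "0 < v"
  shows "integrable (configurations N \<Otimes>\<^sub>M lborel)
          (\<lambda>(\<sigma>, y). boltzmann N \<sigma> * exp (- (v * (y - m_N N \<sigma>)\<^sup>2 / 2)))" (is "integrable _ (case_prod ?g)")
    and "(\<integral>(\<sigma>, y). boltzmann N \<sigma> * exp (- (v * (y - m_N N \<sigma>)\<^sup>2 / 2)) \<partial>(configurations N \<Otimes>\<^sub>M lborel))
          = sqrt (2 * pi / v) * Z_N \<rho> J h N"
proof -
  interpret Q: pair_sigma_finite "configurations N" lborel by (rule pair_sigma_finite_configurations)
  show int: "integrable (configurations N \<Otimes>\<^sub>M lborel) (case_prod ?g)"
  proof (rule Q.Fubini_integrable)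
    show "case_prod ?g \<in> borel_measurable (configurations N \<Otimes>\<^sub>M lborel)"
      by measurable
    have "integrable (configurations N) (\<lambda>\<sigma>. boltzmann N \<sigma> * sqrt (2 * pi / v))"
      by (intro integrable_mult_left integrable_boltzmann)
    also have "(\<lambda>\<sigma>. boltzmann N \<sigma> * sqrt (2 * pi / v)) = (\<lambda>\<sigma>. \<integral>y. norm (case (\<sigma>, y) of (\<sigma>, y) \<Rightarrow> ?g \<sigma> y) \<partial>lborel)"
      using boltzmann_pos by (simp add: abs_mult abs_of_pos gaussian_integral_shift(2)[OF v])
    finally show "integrable (configurations N) (\<lambda>\<sigma>. \<integral>y. norm (case (\<sigma>, y) of (\<sigma>, y) \<Rightarrow> ?g \<sigma> y) \<partial>lborel)" .
    show "AE \<sigma> in configurations N. integrable lborel (\<lambda>y. case (\<sigma>, y) of (\<sigma>, y) \<Rightarrow> ?g \<sigma> y)"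
      by (auto intro!: gaussian_integral_shift(1)[OF v])
  qed
  have "(\<integral>z. case_prod ?g z \<partial>(configurations N \<Otimes>\<^sub>M lborel)) = (\<integral>\<sigma>. (\<integral>y. ?g \<sigma> y \<partial>lborel) \<partial>configurations N)"
    by (rule Q.integral_fst[OF int, symmetric])
  also have "\<dots> = sqrt (2 * pi / v) * Z_N \<rho> J h N"
    by (simp add: gaussian_integral_shift(2)[OF v] Z_N_eq)
  finally show "(\<integral>(\<sigma>, y). ?g \<sigma> y \<partial>(configurations N \<Otimes>\<^sub>M lborel)) = sqrt (2 * pi / v) * Z_N \<rho> J h N" .
qed

lemma integrable_kernel:
  assumes "0 < N"
  shows "integrable (configurations N \<Otimes>\<^sub>M lborel) (\<lambda>(\<sigma>, y). kernel N \<sigma> y)"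
  using boltzmann_gaussian(1)[of "real N * J" N] assms J_pos by (simp add: kernel_eq)

lemma integrable_bounded_kernel:
  fixes \<phi> :: "(nat \<Rightarrow> real) \<Rightarrow> real \<Rightarrow> 'b :: {banach, real_normed_algebra, second_countable_topology}"
  assumes N: "0 < N" and [measurable]: "case_prod \<phi> \<in> borel_measurable (configurations N \<Otimes>\<^sub>M lborel)"
    and "\<And>\<sigma> y. norm (\<phi> \<sigma> y) \<le> 1"
  shows "integrable (configurations N \<Otimes>\<^sub>M lborel) (\<lambda>(\<sigma>, y). kernel N \<sigma> y *\<^sub>R \<phi> \<sigma> y)"
proof (rule Bochner_Integration.integrable_bound[OF integrable_kernel[OF N]])
  have [measurable]: "(\<lambda>(\<sigma>, y). kernel N \<sigma> y) \<in> borel_measurable (configurations N \<Otimes>\<^sub>M lborel)"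
    using integrable_kernel[OF N] by simp
  show "(\<lambda>(\<sigma>, y). kernel N \<sigma> y *\<^sub>R \<phi> \<sigma> y) \<in> borel_measurable (configurations N \<Otimes>\<^sub>M lborel)"
    by (simp add: case_prod_beta')
  show "AE z in configurations N \<Otimes>\<^sub>M lborel. norm (case z of (\<sigma>, y) \<Rightarrow> kernel N \<sigma> y *\<^sub>R \<phi> \<sigma> y)
      \<le> norm (case z of (\<sigma>, y) \<Rightarrow> kernel N \<sigma> y)"
    using assms(3) by (auto simp: kernel_nonneg mult_left_le)
qed

text \<open>Integrating \<open>kernel\<close> in both orders expresses the partition function
  through \<open>f\<close>.\<close>

lemma exp_f_integral:
  assumes "0 < N"
  shows "integrable lborel (\<lambda>y. exp (real N * f y))"
    and "(LBINT y. exp (real N * f y)) = sqrt (2 * pi / (real N * J)) * Z_N \<rho> J h N"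
proof -
  interpret Q: pair_sigma_finite "configurations N" lborel by (rule pair_sigma_finite_configurations)
  note int = integrable_kernel[OF assms]
  show "integrable lborel (\<lambda>y. exp (real N * f y))"
    using Q.integrable_snd[OF int] by (simp add: integral_kernel_configurations)
  have "(LBINT y. exp (real N * f y)) = (\<integral>(\<sigma>, y). kernel N \<sigma> y \<partial>(configurations N \<Otimes>\<^sub>M lborel))"
    using Q.integral_snd[OF int] unfolding integral_kernel_configurations .
  also have "\<dots> = sqrt (2 * pi / (real N * J)) * Z_N \<rho> J h N"
    using boltzmann_gaussian(2)[of "real N * J" N] assms J_pos by (simp add: kernel_eq)
  finally show "(LBINT y. exp (real N * f y)) = sqrt (2 * pi / (real N * J)) * Z_N \<rho> J h N" .
qed

text \<open>The Fourier transform of \<open>m_N - \<mu>\<close> on the conditioning event, without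
  normalization. Dividing by the value at \<open>\<tau> = 0\<close> gives a characteristic
  function.\<close>

definition window_transform :: "nat \<Rightarrow> real \<Rightarrow> real \<Rightarrow> real \<Rightarrow> complex" where
  "window_transform N \<mu> a \<tau> = (\<integral>\<sigma>. boltzmann N \<sigma> *\<^sub>R
     (indicator {x. \<bar>x - \<mu>\<bar> \<le> a} (m_N N \<sigma>) * iexp (\<tau> * (m_N N \<sigma> - \<mu>))) \<partial>configurations N)"

lemma integrable_kernel_window:
  fixes B :: "real set"
  assumes N: "0 < N" and [measurable]: "B \<in> sets borel"
  shows "integrable (configurations N \<Otimes>\<^sub>M lborel)
      (\<lambda>(\<sigma>, y). kernel N \<sigma> y *\<^sub>R (indicator B (m_N N \<sigma>) * iexp (\<tau> * (y - \<mu>))))"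
    and "integrable (configurations N \<Otimes>\<^sub>M lborel)
      (\<lambda>(\<sigma>, y). kernel N \<sigma> y *\<^sub>R (indicator B y * iexp (\<tau> * (y - \<mu>))))"
    and "integrable (configurations N \<Otimes>\<^sub>M lborel) (\<lambda>(\<sigma>, y). kernel N \<sigma> y * indicator B y)"
proof -
  show "integrable (configurations N \<Otimes>\<^sub>M lborel)
      (\<lambda>(\<sigma>, y). kernel N \<sigma> y *\<^sub>R (indicator B (m_N N \<sigma>) * iexp (\<tau> * (y - \<mu>))))"
    by (rule integrable_bounded_kernel[OF N]) (auto simp: norm_mult split: split_indicator)
  show "integrable (configurations N \<Otimes>\<^sub>M lborel)
      (\<lambda>(\<sigma>, y). kernel N \<sigma> y *\<^sub>R (indicator B y * iexp (\<tau> * (y - \<mu>))))"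
    by (rule integrable_bounded_kernel[OF N]) (auto simp: norm_mult split: split_indicator)
  have "integrable (configurations N \<Otimes>\<^sub>M lborel) (\<lambda>(\<sigma>, y). kernel N \<sigma> y *\<^sub>R (indicator B y :: real))"
    by (rule integrable_bounded_kernel[OF N]) (auto split: split_indicator)
  then show "integrable (configurations N \<Otimes>\<^sub>M lborel) (\<lambda>(\<sigma>, y). kernel N \<sigma> y * indicator B y)"
    by simp
qed

text \<open>With the window imposed on the magnetization, \<open>y\<close> is integrated first. The
  Gaussian factor is the same for all configurations and can be pulled out.\<close>

lemma kernel_transform_magnetization:
  assumes N: "0 < N"
  shows "(\<integral>(\<sigma>, y). kernel N \<sigma> y *\<^sub>R (indicator {x. \<bar>x - \<mu>\<bar> \<le> a} (m_N N \<sigma>) * iexp (\<tau> * (y - \<mu>)))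
            \<partial>(configurations N \<Otimes>\<^sub>M lborel))
       = (sqrt (2 * pi / (real N * J)) * exp (- \<tau>\<^sup>2 / (2 * (real N * J)))) * window_transform N \<mu> a \<tau>"
proof -
  interpret Q: pair_sigma_finite "configurations N" lborel by (rule pair_sigma_finite_configurations)
  let ?B = "{x. \<bar>x - \<mu>\<bar> \<le> a}" and ?c = "sqrt (2 * pi / (real N * J)) * exp (- \<tau>\<^sup>2 / (2 * (real N * J)))"
  have v: "0 < real N * J" using N J_pos by simp
  have inner: "(CLBINT y. kernel N \<sigma> y *\<^sub>R (indicator ?B (m_N N \<sigma>) * iexp (\<tau> * (y - \<mu>))))
      = ?c * (boltzmann N \<sigma> *\<^sub>R (indicator ?B (m_N N \<sigma>) * iexp (\<tau> * (m_N N \<sigma> - \<mu>))))" for \<sigma>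
  proof -
    have "(CLBINT y. kernel N \<sigma> y *\<^sub>R (indicator ?B (m_N N \<sigma>) * iexp (\<tau> * (y - \<mu>))))
      = (CLBINT y. (of_real (boltzmann N \<sigma>) * indicator ?B (m_N N \<sigma>)) *
          (iexp (\<tau> * (y - \<mu>)) * exp (- ((real N * J) * (y - m_N N \<sigma>)\<^sup>2 / 2))))"
      unfolding kernel_eq[OF N] by (simp only: scaleR_conv_of_real of_real_mult mult_ac)
    also have "\<dots> = (of_real (boltzmann N \<sigma>) * indicator ?B (m_N N \<sigma>)) * (iexp (\<tau> * (m_N N \<sigma> - \<mu>)) * ?c)"
      unfolding integral_mult_right_zero gaussian_integral_shift(3)[OF v] by simp
    finally show ?thesis
      by (simp only: scaleR_conv_of_real of_real_mult mult_ac)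
  qed
  have "(\<integral>(\<sigma>, y). kernel N \<sigma> y *\<^sub>R (indicator ?B (m_N N \<sigma>) * iexp (\<tau> * (y - \<mu>)))
            \<partial>(configurations N \<Otimes>\<^sub>M lborel))
     = (\<integral>\<sigma>. (CLBINT y. kernel N \<sigma> y *\<^sub>R (indicator ?B (m_N N \<sigma>) * iexp (\<tau> * (y - \<mu>)))) \<partial>configurations N)"
    by (rule Q.integral_fst[symmetric], rule integrable_kernel_window[OF N]) measurable
  also have "\<dots> = ?c * window_transform N \<mu> a \<tau>"
    unfolding inner window_transform_def by (rule integral_mult_right_zero)
  finally show ?thesis .
qed

text \<open>With the window imposed on \<open>y\<close>, the configurations are integrated first,
  which leaves a one-dimensional integral.\<close>

lemma kernel_transform_auxiliary:
  fixes B :: "real set"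
  assumes N: "0 < N" and B: "B \<in> sets borel"
  shows "(\<integral>(\<sigma>, y). kernel N \<sigma> y *\<^sub>R (indicator B y * iexp (\<tau> * (y - \<mu>))) \<partial>(configurations N \<Otimes>\<^sub>M lborel))
       = (CLBINT y. exp (real N * f y) *\<^sub>R (indicator B y * iexp (\<tau> * (y - \<mu>))))"
    and "(\<integral>(\<sigma>, y). kernel N \<sigma> y * indicator B y \<partial>(configurations N \<Otimes>\<^sub>M lborel))
       = (LBINT y. exp (real N * f y) * indicator B y)"
proof -
  interpret Q: pair_sigma_finite "configurations N" lborel by (rule pair_sigma_finite_configurations)
  have inner: "(\<integral>\<sigma>. kernel N \<sigma> y *\<^sub>R z \<partial>configurations N) = exp (real N * f y) *\<^sub>R z" for y and z :: complex
    unfolding scaleR_conv_of_real integral_mult_left_zero integral_complex_of_real integral_kernel_configurations ..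
  show "(\<integral>(\<sigma>, y). kernel N \<sigma> y *\<^sub>R (indicator B y * iexp (\<tau> * (y - \<mu>))) \<partial>(configurations N \<Otimes>\<^sub>M lborel))
       = (CLBINT y. exp (real N * f y) *\<^sub>R (indicator B y * iexp (\<tau> * (y - \<mu>))))"
    using Q.integral_snd[OF integrable_kernel_window(2)[OF N B, of \<tau> \<mu>]] unfolding inner by (rule sym)
  show "(\<integral>(\<sigma>, y). kernel N \<sigma> y * indicator B y \<partial>(configurations N \<Otimes>\<^sub>M lborel))
       = (LBINT y. exp (real N * f y) * indicator B y)"
    using Q.integral_snd[OF integrable_kernel_window(3)[OF N B]]
    unfolding integral_mult_left_zero integral_kernel_configurations by (rule sym)
qed

text \<open>The windows for the magnetization and for the auxiliary variable may be exchanged: a pair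
  on which they differ either has \<open>y\<close> at distance at least \<open>c\<close> from the magnetization, where half of the
  Gaussian exponent buys the exponential factor, or has \<open>y\<close> in the window but away from \<open>\<mu>\<close>.\<close>

lemma window_exchange:
  assumes N: "0 < N" and a: "0 < a" "a < \<delta>" and c: "0 < c" "c \<le> \<delta> - a" "c \<le> a / 2"
  shows "norm ((sqrt (2 * pi / (real N * J)) * exp (- \<tau>\<^sup>2 / (2 * (real N * J)))) * window_transform N \<mu> a \<tau>
       - (CLBINT y. exp (real N * f y) *\<^sub>R (indicator {y. \<bar>y - \<mu>\<bar> \<le> \<delta>} y * iexp (\<tau> * (y - \<mu>)))))
     \<le> sqrt 2 * exp (- (real N * (J * c\<^sup>2 / 4))) * (LBINT y. exp (real N * f y))
       + (LBINT y. exp (real N * f y) * indicator {y. a / 2 \<le> \<bar>y - \<mu>\<bar> \<and> \<bar>y - \<mu>\<bar> \<le> \<delta>} y)"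
proof -
  let ?Q = "configurations N \<Otimes>\<^sub>M lborel"
  let ?B = "{x. \<bar>x - \<mu>\<bar> \<le> a}" and ?D = "{y. \<bar>y - \<mu>\<bar> \<le> \<delta>}"
    and ?R = "{y. a / 2 \<le> \<bar>y - \<mu>\<bar> \<and> \<bar>y - \<mu>\<bar> \<le> \<delta>}"
  let ?e = "\<lambda>y. iexp (\<tau> * (y - \<mu>))"
  let ?E = "exp (- (real N * (J * c\<^sup>2 / 4)))"
  let ?F = "\<lambda>(\<sigma>, y). kernel N \<sigma> y *\<^sub>R (indicator ?B (m_N N \<sigma>) * ?e y)"
  let ?G = "\<lambda>(\<sigma>, y). kernel N \<sigma> y *\<^sub>R (indicator ?D y * ?e y)"
  let ?w = "\<lambda>(\<sigma>, y). boltzmann N \<sigma> * exp (- ((real N * J / 2) * (y - m_N N \<sigma>)\<^sup>2 / 2))"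
  let ?r = "\<lambda>(\<sigma>, y). kernel N \<sigma> y * indicator ?R y"
  have v: "0 < real N * J / 2" using N J_pos by simp
  have sets: "?B \<in> sets borel" "?D \<in> sets borel" "?R \<in> sets borel" by measurable
  note int = integrable_kernel_window(1)[OF N sets(1), of \<tau> \<mu>] integrable_kernel_window(2)[OF N sets(2), of \<tau> \<mu>]
    integrable_kernel_window(3)[OF N sets(3)] boltzmann_gaussian(1)[OF v, of N]
  have "norm ((\<integral>z. ?F z \<partial>?Q) - (\<integral>z. ?G z \<partial>?Q)) = norm (\<integral>z. ?F z - ?G z \<partial>?Q)"
    by (subst Bochner_Integration.integral_diff[OF int(1,2)]) simp
  also have "\<dots> \<le> (\<integral>z. norm (?F z - ?G z) \<partial>?Q)"
    by (rule integral_norm_bound)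
  also have "\<dots> \<le> (\<integral>z. ?E * ?w z + ?r z \<partial>?Q)"
  proof (rule integral_mono)
    show "integrable ?Q (\<lambda>z. norm (?F z - ?G z))"
      by (intro integrable_norm Bochner_Integration.integrable_diff int)
    show "integrable ?Q (\<lambda>z. ?E * ?w z + ?r z)"
      by (intro Bochner_Integration.integrable_add integrable_mult_right int)
    fix z :: "(nat \<Rightarrow> real) \<times> real"
    obtain \<sigma> y where z: "z = (\<sigma>, y)" by force
    let ?m = "m_N N \<sigma>"
    have "norm (?F z - ?G z) = kernel N \<sigma> y * norm ((indicator ?B ?m - indicator ?D y) * ?e y)"
      unfolding z using kernel_nonneg[of N \<sigma> y]
      by (simp add: scaleR_diff_right[symmetric] left_diff_distrib[symmetric])
    also have "\<dots> = kernel N \<sigma> y * \<bar>indicator ?B ?m - indicator ?D y\<bar>"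
      by (simp add: norm_mult split: split_indicator)
    also have "\<dots> \<le> ?E * ?w z + ?r z"
    proof (cases "c \<le> \<bar>y - ?m\<bar>")
      case True
      then have "c\<^sup>2 \<le> (y - ?m)\<^sup>2"
        using c(1) by (metis abs_le_square_iff abs_of_pos)
      then have "real N * J / 4 * c\<^sup>2 \<le> real N * J / 4 * (y - ?m)\<^sup>2"
        using v by (intro mult_left_mono) auto
      then have "exp (- ((real N * J) * (y - ?m)\<^sup>2 / 2)) \<le> ?E * exp (- ((real N * J / 2) * (y - ?m)\<^sup>2 / 2))"
        by (simp add: exp_add[symmetric])
      then have "kernel N \<sigma> y \<le> ?E * ?w z"
        unfolding kernel_eq[OF N] z using boltzmann_pos[of N \<sigma>]
        by (simp add: mult.left_commute mult_left_mono)
      moreover have "kernel N \<sigma> y * \<bar>indicator ?B ?m - indicator ?D y\<bar> \<le> kernel N \<sigma> y * 1"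
        using kernel_nonneg[of N \<sigma> y] by (intro mult_left_mono) (auto split: split_indicator)
      moreover have "0 \<le> ?r z"
        unfolding z using kernel_nonneg[of N \<sigma> y] by simp
      ultimately show ?thesis by linarith
    next
      case False
      moreover have "\<bar>?m - \<mu>\<bar> \<le> \<bar>y - ?m\<bar> + \<bar>y - \<mu>\<bar>" "\<bar>y - \<mu>\<bar> \<le> \<bar>y - ?m\<bar> + \<bar>?m - \<mu>\<bar>"
        by linarith+
      \<comment> \<open>If \<open>\<bar>?m - \<mu>\<bar> \<le> a\<close>, then
        \<open>\<bar>y - \<mu>\<bar> < a + c \<le> \<delta>\<close> and the indicators agree. They
        can differ only if \<open>y\<close> is in the larger window and
        \<open>\<bar>?m - \<mu>\<bar> > a\<close>; then
        \<open>\<bar>y - \<mu>\<bar> > a - c \<ge> a / 2\<close>.\<close>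
      ultimately have "\<bar>indicator ?B ?m - indicator ?D y :: real\<bar> \<le> indicator ?R y"
        using a c by (auto split: split_indicator)
      then have "kernel N \<sigma> y * \<bar>indicator ?B ?m - indicator ?D y\<bar> \<le> ?r z"
        unfolding z using kernel_nonneg[of N \<sigma> y] by (simp add: mult_left_mono)
      moreover have "0 \<le> ?E * ?w z"
        unfolding z using boltzmann_pos[of N \<sigma>] by simp
      ultimately show ?thesis by linarith
    qed
    finally show "norm (?F z - ?G z) \<le> ?E * ?w z + ?r z" .
  qed
  also have "\<dots> = ?E * (\<integral>z. ?w z \<partial>?Q) + (\<integral>z. ?r z \<partial>?Q)"
    by (subst Bochner_Integration.integral_add) (intro integrable_mult_right int, intro int, simp)
  \<comment> \<open>Halving the inverse variance enlarges the Gaussian integral by the factor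
    \<open>sqrt 2\<close>.\<close>
  also have "(\<integral>z. ?w z \<partial>?Q) = sqrt 2 * (LBINT y. exp (real N * f y))"
    unfolding boltzmann_gaussian(2)[OF v] exp_f_integral(2)[OF N]
    by (simp add: real_sqrt_mult[symmetric] real_sqrt_divide[symmetric] field_simps)
  also have "(\<integral>z. ?r z \<partial>?Q) = (LBINT y. exp (real N * f y) * indicator ?R y)"
    by (rule kernel_transform_auxiliary(2)[OF N sets(3)])
  finally show ?thesis
    unfolding kernel_transform_magnetization[OF N] kernel_transform_auxiliary(1)[OF N sets(2)]
    by (simp add: mult_ac)
qed

subsection \<open>Laplace's method\<close>

lemma measurable_f [measurable]: "f \<in> borel_measurable borel"
  using DERIV_f by (intro borel_measurable_continuous_onI continuous_at_imp_continuous_on ballI DERIV_isCont)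

text \<open>On this window \<open>f\<close> lies below its value at \<mu> by at least a multiple of
  \<open>(x - \<mu>) ^ (2 * k)\<close>, so other global maximum points are excluded. The radius
  \<delta> later serves as the bound \<open>A\<close>.\<close>

lemma Taylor_window:
  assumes type: "has_type_strength f \<mu> k lam"
  obtains g \<delta> where "\<And>x. f x = f \<mu> + g x / fact (2 * k) * (x - \<mu>) ^ (2 * k)"
    and "isCont g \<mu>" and "g \<mu> = lam" and "0 < \<delta>" and "\<And>x. \<bar>x - \<mu>\<bar> \<le> \<delta> \<Longrightarrow> g x \<le> lam / 2"
proof -
  have lam: "lam < 0" using type by (simp add: has_type_strength_def)
  obtain g where g: "\<And>x. f x = f \<mu> + g x / fact (2 * k) * (x - \<mu>) ^ (2 * k)"
    "(g \<longlongrightarrow> lam) (at \<mu>)" "g \<mu> = lam"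
    using Taylor_at_maximum[OF type] by blast
  have "\<forall>\<^sub>F x in at \<mu>. g x < lam / 2"
    using g(2) lam by (intro order_tendstoD) auto
  then obtain d where d: "0 < d" "\<And>x. x \<noteq> \<mu> \<Longrightarrow> dist x \<mu> < d \<Longrightarrow> g x < lam / 2"
    by (auto simp: eventually_at)
  show thesis
  proof (rule that[OF g(1)])
    show "isCont g \<mu>" using g(2,3) by (simp add: isCont_def)
    show "g \<mu> = lam" by fact
    show "0 < d / 2" using d(1) by simp
    show "g x \<le> lam / 2" if "\<bar>x - \<mu>\<bar> \<le> d / 2" for x
    proof (cases "x = \<mu>")
      case True
      with g(3) lam show ?thesis by simp
    next
      case False
      with d that show ?thesis by (auto simp: dist_real_def intro: less_imp_le)
    qed
  qed
qed

text \<open>After the substitution \<open>y = \<mu> + x / b n\<close> the factor \<open>N\<close>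
  cancels against \<open>b n ^ (2 * k)\<close>. The integrands converge by continuity of
  \<open>g\<close> at \<mu>, and dominated convergence applies.\<close>

lemma Laplace_limit:
  assumes k: "1 \<le> k" and lam: "lam < 0"
    and g: "\<And>x. f x = f \<mu> + g x / fact (2 * k) * (x - \<mu>) ^ (2 * k)" "isCont g \<mu>" "g \<mu> = lam"
    and \<delta>: "0 < \<delta>" "\<And>x. \<bar>x - \<mu>\<bar> \<le> \<delta> \<Longrightarrow> g x \<le> lam / 2"
    and b: "\<And>n. 0 < b n" "\<And>n. b n ^ (2 * k) = real (Suc n)" "filterlim b at_top sequentially"
  shows "(\<lambda>n. (b n * exp (- (real (Suc n) * f \<mu>))) *\<^sub>R
      (CLBINT y. exp (real (Suc n) * f y) *\<^sub>R (indicator {y. \<bar>y - \<mu>\<bar> \<le> \<delta>} y * iexp (t * b n * (y - \<mu>)))))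
    \<longlonglongrightarrow> (CLBINT x. exp (lam / fact (2 * k) * x ^ (2 * k)) *\<^sub>R iexp (t * x))"
proof -
  define s where "s n x = exp (real (Suc n) * (f (\<mu> + 1 / b n * x) - f \<mu>)) *\<^sub>R
      (indicator {y. \<bar>y - \<mu>\<bar> \<le> \<delta>} (\<mu> + 1 / b n * x) * iexp (t * x))" for n x
  have "(b n * exp (- (real (Suc n) * f \<mu>))) *\<^sub>R
      (CLBINT y. exp (real (Suc n) * f y) *\<^sub>R (indicator {y. \<bar>y - \<mu>\<bar> \<le> \<delta>} y * iexp (t * b n * (y - \<mu>))))
      = (CLBINT x. s n x)" for n
  proof -
    have bn: "0 < b n" by (rule b(1))
    have "(CLBINT y. exp (real (Suc n) * f y) *\<^sub>R (indicator {y. \<bar>y - \<mu>\<bar> \<le> \<delta>} y * iexp (t * b n * (y - \<mu>))))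
      = \<bar>1 / b n\<bar> *\<^sub>R (CLBINT x. exp (real (Suc n) * f (\<mu> + 1 / b n * x)) *\<^sub>R
          (indicator {y. \<bar>y - \<mu>\<bar> \<le> \<delta>} (\<mu> + 1 / b n * x) * iexp (t * b n * ((\<mu> + 1 / b n * x) - \<mu>))))"
      using bn by (intro lborel_integral_real_affine) simp
    also have "(\<lambda>x. t * b n * ((\<mu> + 1 / b n * x) - \<mu>)) = (\<lambda>x. t * x)"
      using bn by auto
    also have "(CLBINT x. exp (real (Suc n) * f (\<mu> + 1 / b n * x)) *\<^sub>R
          (indicator {y. \<bar>y - \<mu>\<bar> \<le> \<delta>} (\<mu> + 1 / b n * x) * iexp (t * x)))
       = (CLBINT x. exp (real (Suc n) * f \<mu>) *\<^sub>R s n x)"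
      unfolding s_def scaleR_scaleR exp_add[symmetric] by (simp add: algebra_simps del: of_nat_Suc)
    also have "\<dots> = exp (real (Suc n) * f \<mu>) *\<^sub>R (CLBINT x. s n x)"
      by (rule integral_scaleR_right)
    finally show ?thesis
      using bn by (simp add: exp_minus field_simps del: of_nat_Suc)
  qed
  moreover have "(\<lambda>n. CLBINT x. s n x) \<longlonglongrightarrow> (CLBINT x. exp (lam / fact (2 * k) * x ^ (2 * k)) *\<^sub>R iexp (t * x))"
  proof (rule integral_dominated_convergence)
    have exponent: "real (Suc n) * (f (\<mu> + 1 / b n * x) - f \<mu>)
        = g (\<mu> + 1 / b n * x) / fact (2 * k) * x ^ (2 * k)" for n x
    proof -
      have "real (Suc n) * (1 / b n * x) ^ (2 * k) = x ^ (2 * k)"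
        using b(1)[of n] unfolding b(2)[of n, symmetric] by (simp add: power_mult_distrib power_divide)
      then show ?thesis
        by (subst g(1)) (simp add: mult.left_commute del: of_nat_Suc)
    qed
    \<comment> \<open>Where the indicator is nonzero, \<open>g \<le> lam / 2\<close>; half of the
      strength thus gives a dominating function independent of \<open>n\<close>.\<close>
    show "integrable lborel (\<lambda>x. exp (- ((- lam / 2 / fact (2 * k)) * x ^ (2 * k))))"
      using lam k by (intro integrable_exp_even_power) (auto simp: divide_neg_pos)
    show "AE x in lborel. norm (s n x) \<le> exp (- ((- lam / 2 / fact (2 * k)) * x ^ (2 * k)))" for n
    proof (intro AE_I2)
      fix x :: real
      show "norm (s n x) \<le> exp (- ((- lam / 2 / fact (2 * k)) * x ^ (2 * k)))"
      proof (cases "\<bar>\<mu> + 1 / b n * x - \<mu>\<bar> \<le> \<delta>")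
        case True
        then have "g (\<mu> + 1 / b n * x) / fact (2 * k) * x ^ (2 * k) \<le> lam / 2 / fact (2 * k) * x ^ (2 * k)"
          by (intro mult_right_mono divide_right_mono \<delta>(2)) auto
        then show ?thesis
          unfolding s_def exponent by (simp add: norm_mult split: split_indicator)
      qed (simp add: s_def)
    qed
    show "AE x in lborel. (\<lambda>n. s n x) \<longlonglongrightarrow> exp (lam / fact (2 * k) * x ^ (2 * k)) *\<^sub>R iexp (t * x)"
    proof (intro AE_I2)
      fix x :: real
      have "(\<lambda>n. x / b n) \<longlonglongrightarrow> 0"
        using b(3) by (rule tendsto_divide_0[OF tendsto_const filterlim_at_top_imp_at_infinity])
      then have to_\<mu>: "(\<lambda>n. \<mu> + 1 / b n * x) \<longlonglongrightarrow> \<mu>"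
        using tendsto_add[OF tendsto_const, of "\<lambda>n. x / b n" 0 sequentially \<mu>] by simp
      have "(\<lambda>n. exp (real (Suc n) * (f (\<mu> + 1 / b n * x) - f \<mu>)) *\<^sub>R iexp (t * x))
          \<longlonglongrightarrow> exp (lam / fact (2 * k) * x ^ (2 * k)) *\<^sub>R iexp (t * x)"
        unfolding exponent using isCont_tendsto_compose[OF g(2) to_\<mu>] unfolding g(3)
        by (intro tendsto_intros) auto
      \<comment> \<open>For fixed \<open>x\<close> the rescaled point eventually enters the window,
        and the indicator becomes 1.\<close>
      moreover have "\<forall>\<^sub>F n in sequentially. exp (real (Suc n) * (f (\<mu> + 1 / b n * x) - f \<mu>)) *\<^sub>R iexp (t * x) = s n x"
        using tendstoD[OF to_\<mu> \<delta>(1)]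
        by eventually_elim (simp add: s_def dist_real_def)
      ultimately show "(\<lambda>n. s n x) \<longlonglongrightarrow> exp (lam / fact (2 * k) * x ^ (2 * k)) *\<^sub>R iexp (t * x)"
        by (rule Lim_transform_eventually)
    qed
    show "s n \<in> borel_measurable lborel" for n
      unfolding s_def by measurable
  qed measurable
  ultimately show ?thesis by simp
qed

text \<open>Since \<open>f y - f \<mu>\<close> is nonpositive, its multiple by \<open>N\<close> is
  largest at \<open>N = 1\<close>. This crude bound, uniform in \<open>N\<close>, is enough against
  an exponentially small factor.\<close>

lemma exp_f_integral_le:
  assumes glob_max: "\<And>x. f x \<le> f \<mu>" and N: "0 < N"
  shows "exp (- (real N * f \<mu>)) * (LBINT y. exp (real N * f y)) \<le> exp (- f \<mu>) * (LBINT y. exp (f y))"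
proof -
  have int: "integrable lborel (\<lambda>y. exp (f y))"
    using exp_f_integral(1)[of 1] by simp
  have "exp (- (real N * f \<mu>)) * (LBINT y. exp (real N * f y)) = (LBINT y. exp (- (real N * f \<mu>)) * exp (real N * f y))"
    by simp
  also have "\<dots> \<le> (LBINT y. exp (- f \<mu>) * exp (f y))"
  proof (rule integral_mono)
    fix y
    have "(real N - 1) * f y \<le> (real N - 1) * f \<mu>"
      using N by (intro mult_left_mono glob_max) auto
    then show "exp (- (real N * f \<mu>)) * exp (real N * f y) \<le> exp (- f \<mu>) * exp (f y)"
      by (simp add: exp_add[symmetric] algebra_simps)
  qed (auto intro!: integrable_mult_right int exp_f_integral(1) N)
  finally show ?thesis by simp
qed

text \<open>On the annulus \<open>f\<close> stays below \<open>f \<mu>\<close> by the fixed gap in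
  the exponent, and the annulus lies in an interval of length \<open>2 * \<delta>\<close>.\<close>

lemma annulus_integral_le:
  assumes lam: "lam < 0"
    and g: "\<And>x. f x = f \<mu> + g x / fact (2 * k) * (x - \<mu>) ^ (2 * k)"
    and \<delta>: "0 < \<delta>" "\<And>x. \<bar>x - \<mu>\<bar> \<le> \<delta> \<Longrightarrow> g x \<le> lam / 2" and r: "0 < r"
  shows "exp (- (real N * f \<mu>)) * (LBINT y. exp (real N * f y) * indicator {y. r \<le> \<bar>y - \<mu>\<bar> \<and> \<bar>y - \<mu>\<bar> \<le> \<delta>} y)
      \<le> 2 * \<delta> * exp (- (real N * (- lam / 2 / fact (2 * k) * r ^ (2 * k))))"
proof -
  let ?A = "{y. r \<le> \<bar>y - \<mu>\<bar> \<and> \<bar>y - \<mu>\<bar> \<le> \<delta>}" and ?\<eta> = "- lam / 2 / fact (2 * k) * r ^ (2 * k)"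
  have "exp (- (real N * f \<mu>)) * (LBINT y. exp (real N * f y) * indicator ?A y)
     = (LBINT y. exp (- (real N * f \<mu>)) * (exp (real N * f y) * indicator ?A y))"
    by simp
  also have "\<dots> \<le> (LBINT y. exp (- (real N * ?\<eta>)) * indicator {\<mu> - \<delta>..\<mu> + \<delta>} y)"
  proof (rule integral_mono')
    show "integrable lborel (\<lambda>y. exp (- (real N * ?\<eta>)) * indicator {\<mu> - \<delta>..\<mu> + \<delta>} y)"
      by (intro integrable_mult_right integrable_real_indicator) (auto simp: emeasure_lborel_Icc_eq)
    fix y
    show "exp (- (real N * f \<mu>)) * (exp (real N * f y) * indicator ?A y)
       \<le> exp (- (real N * ?\<eta>)) * indicator {\<mu> - \<delta>..\<mu> + \<delta>} y"
    proof (cases "y \<in> ?A")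
      case True
      then have y: "r \<le> \<bar>y - \<mu>\<bar>" "\<bar>y - \<mu>\<bar> \<le> \<delta>" by auto
      have "r ^ (2 * k) \<le> \<bar>y - \<mu>\<bar> ^ (2 * k)"
        using y r by (intro power_mono) auto
      then have pow: "r ^ (2 * k) \<le> (y - \<mu>) ^ (2 * k)"
        by (simp add: power_mult)
      have "g y / fact (2 * k) * (y - \<mu>) ^ (2 * k) \<le> lam / 2 / fact (2 * k) * (y - \<mu>) ^ (2 * k)"
        using \<delta>(2)[OF y(2)] by (intro mult_right_mono divide_right_mono) auto
      also have "\<dots> \<le> lam / 2 / fact (2 * k) * r ^ (2 * k)"
        using lam pow by (intro mult_left_mono_neg) (auto simp: divide_nonpos_pos)
      finally have "f y \<le> f \<mu> - ?\<eta>"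
        using g[of y] by simp
      then have "real N * f y \<le> real N * (f \<mu> - ?\<eta>)"
        by (intro mult_left_mono) auto
      then have "exp (- (real N * f \<mu>)) * exp (real N * f y) \<le> exp (- (real N * ?\<eta>))"
        unfolding exp_add[symmetric] exp_le_cancel_iff by (simp only: right_diff_distrib)
      moreover have "y \<in> {\<mu> - \<delta>..\<mu> + \<delta>}" using y by auto
      ultimately show ?thesis using True by simp
    qed simp
  qed auto
  also have "\<dots> = 2 * \<delta> * exp (- (real N * ?\<eta>))"
    using \<delta>(1) by simp
  finally show ?thesis .
qed

subsection \<open>The conditional laws\<close>

text \<open>The Laplace limit passes from the window for \<open>y\<close> to the window for the
  magnetization: the exchange error is exponentially small relative to
  \<open>exp (N * f \<mu>)\<close>, while the prefactor \<open>b n\<close> grows only like a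
  power.\<close>

lemma window_transform_limit:
  fixes \<mu> :: real and k :: nat
  defines "b \<equiv> \<lambda>n. real (Suc n) powr (1 / (2 * real k))"
  assumes glob_max: "\<And>x. f x \<le> f \<mu>" and k: "1 \<le> k" and lam: "lam < 0"
    and g: "\<And>x. f x = f \<mu> + g x / fact (2 * k) * (x - \<mu>) ^ (2 * k)" "isCont g \<mu>" "g \<mu> = lam"
    and \<delta>: "0 < \<delta>" "\<And>x. \<bar>x - \<mu>\<bar> \<le> \<delta> \<Longrightarrow> g x \<le> lam / 2"
    and a: "0 < a" "a < \<delta>"
  shows "(\<lambda>n. (b n * exp (- (real (Suc n) * f \<mu>))) *\<^sub>R
      ((sqrt (2 * pi / (real (Suc n) * J)) * exp (- (t * b n)\<^sup>2 / (2 * (real (Suc n) * J)))) *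
        window_transform (Suc n) \<mu> a (t * b n)))
    \<longlonglongrightarrow> (CLBINT x. exp (lam / fact (2 * k) * x ^ (2 * k)) *\<^sub>R iexp (t * x))"
    (is "?F \<longlonglongrightarrow> ?L")
proof -
  \<comment> \<open>The largest distance allowed by both constraints of
    \<open>window_exchange\<close>.\<close>
  define c where "c = min (\<delta> - a) (a / 2)"
  have c: "0 < c" "c \<le> \<delta> - a" "c \<le> a / 2" using a by (auto simp: c_def min_def)
  let ?r = "\<lambda>n. b n * exp (- (real (Suc n) * f \<mu>))"
  let ?G = "\<lambda>n. ?r n *\<^sub>R
      (CLBINT y. exp (real (Suc n) * f y) *\<^sub>R (indicator {y. \<bar>y - \<mu>\<bar> \<le> \<delta>} y * iexp (t * b n * (y - \<mu>))))"
  let ?K = "exp (- f \<mu>) * (LBINT y. exp (f y))" and ?\<eta>1 = "J * c\<^sup>2 / 4"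
    and ?\<eta>2 = "- lam / 2 / fact (2 * k) * (a / 2) ^ (2 * k)"
  let ?err = "\<lambda>n. b n * (sqrt 2 * ?K * exp (- (real (Suc n) * ?\<eta>1)) + 2 * \<delta> * exp (- (real (Suc n) * ?\<eta>2)))"
  have "0 < ?\<eta>1" "0 < 1 / (2 * real k)"
    using J_pos c k by auto
  moreover have "0 < ?\<eta>2"
    using lam a by (intro mult_pos_pos divide_pos_pos zero_less_power) auto
  ultimately have \<eta>: "0 < ?\<eta>1" "0 < ?\<eta>2" "0 < 1 / (2 * real k)"
    by auto
  have decay: "(\<lambda>n. b n * exp (- (real (Suc n) * \<eta>))) \<longlonglongrightarrow> 0" if "0 < \<eta>" for \<eta>
    using that \<eta>(3) unfolding b_def by real_asymp
  have "(\<lambda>n. sqrt 2 * ?K * (b n * exp (- (real (Suc n) * ?\<eta>1))) + 2 * \<delta> * (b n * exp (- (real (Suc n) * ?\<eta>2)))) \<longlonglongrightarrow>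
      sqrt 2 * ?K * 0 + 2 * \<delta> * 0"
    by (intro tendsto_intros decay \<eta>)
  then have err: "?err \<longlonglongrightarrow> 0"
    by (simp add: algebra_simps)
  have bound: "norm (?F n - ?G n) \<le> ?err n" for n
  proof -
    have b: "0 < b n" by (simp add: b_def)
    let ?X = "sqrt 2 * exp (- (real (Suc n) * ?\<eta>1)) * (LBINT y. exp (real (Suc n) * f y))"
    let ?Y = "LBINT y. exp (real (Suc n) * f y) * indicator {y. a / 2 \<le> \<bar>y - \<mu>\<bar> \<and> \<bar>y - \<mu>\<bar> \<le> \<delta>} y"
    have "norm (?F n - ?G n) = ?r n * norm ((sqrt (2 * pi / (real (Suc n) * J)) * exp (- (t * b n)\<^sup>2 / (2 * (real (Suc n) * J)))) *
        window_transform (Suc n) \<mu> a (t * b n) -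
       (CLBINT y. exp (real (Suc n) * f y) *\<^sub>R (indicator {y. \<bar>y - \<mu>\<bar> \<le> \<delta>} y * iexp (t * b n * (y - \<mu>)))))"
      using b unfolding scaleR_diff_right[symmetric] norm_scaleR by simp
    also have "\<dots> \<le> ?r n * (?X + ?Y)"
      using b by (intro mult_left_mono window_exchange a c) auto
    also have "\<dots> = b n * (sqrt 2 * exp (- (real (Suc n) * ?\<eta>1)) * (exp (- (real (Suc n) * f \<mu>)) * (LBINT y. exp (real (Suc n) * f y)))
        + exp (- (real (Suc n) * f \<mu>)) * ?Y)"
      by (simp only: distrib_left mult_ac)
    also have "\<dots> \<le> b n * (sqrt 2 * exp (- (real (Suc n) * ?\<eta>1)) * ?K + 2 * \<delta> * exp (- (real (Suc n) * ?\<eta>2)))"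
      using b a(1)
      by (intro mult_left_mono add_mono exp_f_integral_le[OF glob_max] annulus_integral_le[OF lam g(1) \<delta>]) auto
    finally show ?thesis by (simp only: mult_ac)
  qed
  have "(\<lambda>n. ?F n - ?G n) \<longlonglongrightarrow> 0"
    by (rule Lim_null_comparison[OF eventually_sequentiallyI[of 0, OF bound] err])
  moreover have "?G \<longlonglongrightarrow> ?L"
    by (rule Laplace_limit[OF k lam g \<delta>]) (auto simp: b_def powr_scale[OF k] simp del: of_nat_Suc)
  ultimately show ?thesis
    using tendsto_add[of "\<lambda>n. ?F n - ?G n" 0 sequentially ?G ?L] by simp
qed

text \<open>The mass of the conditioning event before division by \<open>Z_N\<close>, as a real
  number; it is the value of \<open>window_transform\<close> at frequency 0.\<close>

definition window_weight :: "nat \<Rightarrow> real \<Rightarrow> real \<Rightarrow> real" where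
  "window_weight N \<mu> a = (\<integral>\<sigma>. boltzmann N \<sigma> * indicator {x. \<bar>x - \<mu>\<bar> \<le> a} (m_N N \<sigma>) \<partial>configurations N)"

lemma window_weight_nonneg: "0 \<le> window_weight N \<mu> a"
  unfolding window_weight_def using boltzmann_pos
  by (intro integral_nonneg_AE AE_I2 mult_nonneg_nonneg) (auto intro: less_imp_le)

lemma window_transform_0: "window_transform N \<mu> a 0 = window_weight N \<mu> a"
proof -
  have "window_transform N \<mu> a 0 =
      (\<integral>\<sigma>. complex_of_real (boltzmann N \<sigma> * indicator {x. \<bar>x - \<mu>\<bar> \<le> a} (m_N N \<sigma>)) \<partial>configurations N)"
    unfolding window_transform_def
    by (intro Bochner_Integration.integral_cong) (auto simp: scaleR_conv_of_real split: split_indicator)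
  then show ?thesis
    unfolding window_weight_def by (simp only: integral_complex_of_real)
qed

section \<open>Density and characteristic function of the conditional law\<close>

abbreviation window :: "nat \<Rightarrow> real \<Rightarrow> real \<Rightarrow> (nat \<Rightarrow> real) set" where
  "window N \<mu> a \<equiv> {\<sigma> \<in> space (P_N \<rho> J h N). \<bar>m_N N \<sigma> - \<mu>\<bar> \<le> a}"

lemma P_N_eq: "P_N \<rho> J h N = density (configurations N) (\<lambda>\<sigma>. ennreal (boltzmann N \<sigma> / Z_N \<rho> J h N))"
  by (simp add: P_N_def boltzmann_def)

lemma window_sets: "window N \<mu> a \<in> sets (P_N \<rho> J h N)"
  unfolding P_N_eq by simp

lemma emeasure_window: "emeasure (P_N \<rho> J h N) (window N \<mu> a) = ennreal (window_weight N \<mu> a / Z_N \<rho> J h N)"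
proof -
  have "emeasure (P_N \<rho> J h N) (window N \<mu> a)
     = (\<integral>\<^sup>+\<sigma>. ennreal (boltzmann N \<sigma> / Z_N \<rho> J h N) * indicator (window N \<mu> a) \<sigma> \<partial>configurations N)"
    using window_sets[of N \<mu> a] unfolding P_N_eq by (subst emeasure_density) auto
  also have "\<dots> = (\<integral>\<^sup>+\<sigma>. ennreal (boltzmann N \<sigma> * indicator {x. \<bar>x - \<mu>\<bar> \<le> a} (m_N N \<sigma>) / Z_N \<rho> J h N) \<partial>configurations N)"
    by (intro nn_integral_cong) (auto simp: P_N_eq split: split_indicator)
  also have "\<dots> = ennreal (\<integral>\<sigma>. boltzmann N \<sigma> * indicator {x. \<bar>x - \<mu>\<bar> \<le> a} (m_N N \<sigma>) / Z_N \<rho> J h N \<partial>configurations N)"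
  proof (rule nn_integral_eq_integral)
    have "integrable (configurations N) (\<lambda>\<sigma>. boltzmann N \<sigma> * indicator {x. \<bar>x - \<mu>\<bar> \<le> a} (m_N N \<sigma>))"
      by (rule Bochner_Integration.integrable_bound[OF integrable_boltzmann]) (auto split: split_indicator)
    then show "integrable (configurations N) (\<lambda>\<sigma>. boltzmann N \<sigma> * indicator {x. \<bar>x - \<mu>\<bar> \<le> a} (m_N N \<sigma>) / Z_N \<rho> J h N)"
      by (rule integrable_divide)
  qed (use boltzmann_pos Z_N_pos in \<open>auto simp: less_imp_le\<close>)
  also have "\<dots> = ennreal (window_weight N \<mu> a / Z_N \<rho> J h N)"
    unfolding window_weight_def by simp
  finally show ?thesis .
qed

text \<open>The partition function cancels between the density of \<open>P_N\<close> and the mass of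
  the window.\<close>

lemma uniform_measure_window:
  assumes w: "0 < window_weight N \<mu> a"
  shows "uniform_measure (P_N \<rho> J h N) (window N \<mu> a) = density (configurations N)
     (\<lambda>\<sigma>. ennreal (boltzmann N \<sigma> * indicator {x. \<bar>x - \<mu>\<bar> \<le> a} (m_N N \<sigma>) / window_weight N \<mu> a))"
proof -
  note Z = Z_N_pos[of N]
  have meas: "(\<lambda>\<sigma>. indicator (window N \<mu> a) \<sigma> / ennreal (window_weight N \<mu> a / Z_N \<rho> J h N))
     \<in> borel_measurable (configurations N)"
    using window_sets[of N \<mu> a] unfolding P_N_eq by measurable
  have "uniform_measure (P_N \<rho> J h N) (window N \<mu> a) = density (configurations N)
     (\<lambda>\<sigma>. ennreal (boltzmann N \<sigma> / Z_N \<rho> J h N) * (indicator (window N \<mu> a) \<sigma> / ennreal (window_weight N \<mu> a / Z_N \<rho> J h N)))"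
    unfolding uniform_measure_def emeasure_window
    unfolding P_N_eq using meas by (intro density_density_eq) (auto simp: P_N_eq)
  also have "\<dots> = density (configurations N)
     (\<lambda>\<sigma>. ennreal (boltzmann N \<sigma> * indicator {x. \<bar>x - \<mu>\<bar> \<le> a} (m_N N \<sigma>) / window_weight N \<mu> a))"
  proof (rule density_cong)
    show "AE \<sigma> in configurations N. ennreal (boltzmann N \<sigma> / Z_N \<rho> J h N) *
        (indicator (window N \<mu> a) \<sigma> / ennreal (window_weight N \<mu> a / Z_N \<rho> J h N)) =
      ennreal (boltzmann N \<sigma> * indicator {x. \<bar>x - \<mu>\<bar> \<le> a} (m_N N \<sigma>) / window_weight N \<mu> a)"
    proof (intro AE_I2)
      fix \<sigma> assume \<sigma>: "\<sigma> \<in> space (configurations N)"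
      have "(indicator (window N \<mu> a) \<sigma> :: ennreal) = ennreal (indicator {x. \<bar>x - \<mu>\<bar> \<le> a} (m_N N \<sigma>))"
        using \<sigma> by (auto simp: P_N_eq split: split_indicator)
      then show "ennreal (boltzmann N \<sigma> / Z_N \<rho> J h N) *
          (indicator (window N \<mu> a) \<sigma> / ennreal (window_weight N \<mu> a / Z_N \<rho> J h N)) =
        ennreal (boltzmann N \<sigma> * indicator {x. \<bar>x - \<mu>\<bar> \<le> a} (m_N N \<sigma>) / window_weight N \<mu> a)"
        using w Z boltzmann_pos[of N \<sigma>]
        by (simp add: divide_ennreal ennreal_mult[symmetric])
    qed
  qed (use meas in measurable)
  finally show ?thesis .
qed

lemma S_bar_eq:
  assumes "0 < N"
  shows "S_bar k \<mu> N \<sigma> = real N powr (1 / (2 * real k)) * (m_N N \<sigma> - \<mu>)"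
proof -
  have "real N powr (1 - 1 / (2 * real k)) = real N / real N powr (1 / (2 * real k))"
    using assms by (simp add: powr_diff)
  then show ?thesis
    using assms by (simp add: S_bar_def m_N_def field_simps)
qed

text \<open>As \<open>S_bar\<close> is a multiple of \<open>m_N - \<mu>\<close>, frequency
  \<open>t\<close> for the former is the rescaled frequency for the latter.\<close>

lemma conditional_law:
  fixes k N :: nat
  assumes N: "0 < N" and w: "0 < window_weight N \<mu> a"
  defines "law \<equiv> distr (uniform_measure (P_N \<rho> J h N) (window N \<mu> a)) borel (S_bar k \<mu> N)"
  shows "real_distribution law"
    and "char law t = window_transform N \<mu> a (t * real N powr (1 / (2 * real k))) / window_transform N \<mu> a 0"
proof -
  let ?U = "uniform_measure (P_N \<rho> J h N) (window N \<mu> a)"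
  let ?b = "real N powr (1 / (2 * real k))"
  have S_bar: "S_bar k \<mu> N = (\<lambda>\<sigma>. ?b * (m_N N \<sigma> - \<mu>))"
    using S_bar_eq[OF N] by auto
  have meas [measurable]: "S_bar k \<mu> N \<in> borel_measurable (configurations N)"
    unfolding S_bar by measurable
  have measU: "S_bar k \<mu> N \<in> borel_measurable ?U"
    using meas by (simp add: P_N_eq)
  interpret U: prob_space ?U
    using w Z_N_pos[of N] by (intro prob_space_uniform_measure) (auto simp: emeasure_window divide_le_0_iff)
  interpret L: prob_space law
    unfolding law_def by (rule U.prob_space_distr[OF measU])
  show "real_distribution law"
    by standard (simp add: law_def)
  have "char law t = (\<integral>\<sigma>. iexp (t * S_bar k \<mu> N \<sigma>) \<partial>?U)"
    unfolding char_def law_def by (rule integral_distr[OF measU]) measurable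
  also have "\<dots> = (\<integral>\<sigma>. (boltzmann N \<sigma> * indicator {x. \<bar>x - \<mu>\<bar> \<le> a} (m_N N \<sigma>) / window_weight N \<mu> a) *\<^sub>R
      iexp (t * S_bar k \<mu> N \<sigma>) \<partial>configurations N)"
    unfolding uniform_measure_window[OF w] using w boltzmann_pos
    by (intro integral_density) (auto simp: less_imp_le)
  also have "\<dots> = (\<integral>\<sigma>. (boltzmann N \<sigma> *\<^sub>R
     (indicator {x. \<bar>x - \<mu>\<bar> \<le> a} (m_N N \<sigma>) * iexp (t * ?b * (m_N N \<sigma> - \<mu>)))) / window_weight N \<mu> a \<partial>configurations N)"
    by (intro Bochner_Integration.integral_cong)
       (auto simp: S_bar scaleR_conv_of_real mult.assoc split: split_indicator)
  also have "\<dots> = window_transform N \<mu> a (t * ?b) / window_transform N \<mu> a 0"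
    unfolding window_transform_0 by (simp add: window_transform_def)
  finally show "char law t = window_transform N \<mu> a (t * ?b) / window_transform N \<mu> a 0" .
qed

text \<open>Both cases of the theorem at once: \<open>E\<close> is the limit of the Gaussian factor
  from the coupling, and the candidate \<open>M'\<close> is determined by dividing the normalized
  Laplace limit by \<open>E\<close>.\<close>

lemma conditional_weak_limit:
  fixes \<mu> lam :: real and k :: nat
  defines "l \<equiv> LBINT x. exp (lam / fact (2 * k) * x ^ (2 * k))"
  assumes glob_max: "\<And>x. f x \<le> f \<mu>" and type: "has_type_strength f \<mu> k lam"
    and E: "\<And>t. (\<lambda>n. exp (- (t * real (Suc n) powr (1 / (2 * real k)))\<^sup>2 / (2 * (real (Suc n) * J)))) \<longlonglongrightarrow> E t"
      "\<And>t. E t \<noteq> 0"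
    and M': "real_distribution M'"
      "\<And>t. char M' t * E t = (CLBINT x. exp (lam / fact (2 * k) * x ^ (2 * k)) *\<^sub>R iexp (t * x)) / l"
  shows "\<exists>A>0. \<forall>a. 0 < a \<and> a < A \<longrightarrow> weak_conv_m
    (\<lambda>n. distr (uniform_measure (P_N \<rho> J h (Suc n)) (window (Suc n) \<mu> a)) borel (S_bar k \<mu> (Suc n))) M'"
proof -
  have k: "1 \<le> k" and lam: "lam < 0" using type by (auto simp: has_type_strength_def)
  obtain g \<delta> where g: "\<And>x. f x = f \<mu> + g x / fact (2 * k) * (x - \<mu>) ^ (2 * k)" "isCont g \<mu>" "g \<mu> = lam"
    and \<delta>: "0 < \<delta>" "\<And>x. \<bar>x - \<mu>\<bar> \<le> \<delta> \<Longrightarrow> g x \<le> lam / 2"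
    using Taylor_window[OF type] by blast
  let ?L = "\<lambda>t. CLBINT x. exp (lam / fact (2 * k) * x ^ (2 * k)) *\<^sub>R iexp (t * x)"
  let ?b = "\<lambda>n. real (Suc n) powr (1 / (2 * real k))"
  let ?E = "\<lambda>n t. exp (- (t * ?b n)\<^sup>2 / (2 * (real (Suc n) * J)))"
  have l: "0 < l" "?L 0 = l"
    using even_power_density_pos[OF lam k] unfolding l_def by (simp_all add: scaleR_conv_of_real)
  show ?thesis
  proof (intro exI[of _ \<delta>] conjI allI impI \<delta>(1))
    fix a assume "0 < a \<and> a < \<delta>"
    then have a: "0 < a" "a < \<delta>" by auto
    \<comment> \<open>All factors that do not depend on \<open>t\<close>; they cancel in the
      quotient of transforms.\<close>
    define \<kappa> where "\<kappa> n = ?b n * exp (- (real (Suc n) * f \<mu>)) * sqrt (2 * pi / (real (Suc n) * J))" for n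
    let ?W = "\<lambda>n t. window_transform (Suc n) \<mu> a (t * ?b n)"
    let ?law = "\<lambda>n. distr (uniform_measure (P_N \<rho> J h (Suc n)) (window (Suc n) \<mu> a)) borel (S_bar k \<mu> (Suc n))"
    have \<kappa>: "\<kappa> n \<noteq> 0" for n
      using J_pos by (simp add: \<kappa>_def del: of_nat_Suc)
    have lim: "(\<lambda>n. of_real (\<kappa> n) * (of_real (?E n t) * ?W n t)) \<longlonglongrightarrow> ?L t" for t
      using window_transform_limit[OF glob_max k lam g \<delta> a, of t]
      by (simp add: \<kappa>_def scaleR_conv_of_real mult_ac del: of_nat_Suc)
    \<comment> \<open>Frequency 0 has a positive limit. Hence the conditioning event eventually has
      positive mass, and the quotient of limits is legitimate.\<close>
    have lim0: "(\<lambda>n. of_real (\<kappa> n) * ?W n 0) \<longlonglongrightarrow> ?L 0"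
      using lim[of 0] by simp
    have "\<forall>\<^sub>F n in sequentially. of_real (\<kappa> n) * ?W n 0 \<noteq> 0"
      using tendsto_imp_eventually_ne[OF lim0, of 0] l by simp
    then have "\<forall>\<^sub>F n in sequentially. 0 < window_weight (Suc n) \<mu> a"
    proof eventually_elim
      case (elim n)
      then show ?case
        using window_weight_nonneg[of "Suc n" \<mu> a] by (simp add: window_transform_0 less_le)
    qed
    \<comment> \<open>For small \<open>n\<close> the conditioning event can be null and the conditional law the zero measure.\<close>
    then obtain n0 where w: "\<And>n. n0 \<le> n \<Longrightarrow> 0 < window_weight (Suc n) \<mu> a"
      by (auto simp: eventually_sequentially)
    have "weak_conv_m (\<lambda>n. ?law (n + n0)) M'"
    proof (rule levy_continuity)
      show "real_distribution (?law (n + n0))" for n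
        by (intro conditional_law(1) w) auto
      show "real_distribution M'" by (rule M'(1))
      fix t
      have "(\<lambda>n. (of_real (\<kappa> n) * (of_real (?E n t) * ?W n t)) / (of_real (\<kappa> n) * ?W n 0) / of_real (?E n t))
          \<longlonglongrightarrow> ?L t / ?L 0 / of_real (E t)"
        using l E(2) by (intro tendsto_divide lim lim0 tendsto_of_real E(1)) auto
      moreover have "?L t / ?L 0 / of_real (E t) = char M' t"
        unfolding l(2) M'(2)[of t, symmetric] using E(2)[of t] by simp
      ultimately have "(\<lambda>n. (of_real (\<kappa> n) * (of_real (?E n t) * ?W n t)) / (of_real (\<kappa> n) * ?W n 0) / of_real (?E n t))
          \<longlonglongrightarrow> char M' t"
        by simp
      moreover have "(\<lambda>n. (of_real (\<kappa> n) * (of_real (?E n t) * ?W n t)) / (of_real (\<kappa> n) * ?W n 0) / of_real (?E n t))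
          = (\<lambda>n. ?W n t / ?W n 0)"
        using \<kappa> by (simp add: field_simps del: of_nat_Suc)
      ultimately have "(\<lambda>n. ?W n t / ?W n 0) \<longlonglongrightarrow> char M' t" by simp
      then have "(\<lambda>n. ?W (n + n0) t / ?W (n + n0) 0) \<longlonglongrightarrow> char M' t"
        by (rule LIMSEQ_ignore_initial_segment)
      also have "(\<lambda>n. ?W (n + n0) t / ?W (n + n0) 0) = (\<lambda>n. char (?law (n + n0)) t)"
        using conditional_law(2)[OF _ w] by simp
      finally show "(\<lambda>n. char (?law (n + n0)) t) \<longlonglongrightarrow> char M' t" .
    qed
    then show "weak_conv_m ?law M'"
      by (rule weak_conv_m_offset)
  qed
qed

end

text \<open>The cases differ in the limit of the Gaussian factor, governed by
  \<open>N powr (1 / k - 1)\<close>: this is constantly 1 for \<open>k = 1\<close> and tends to 0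
  for \<open>k \<ge> 2\<close>.\<close>

theorem theorem3:
  fixes \<rho> :: "real measure" and J h \<mu> lam :: real and k :: nat
  assumes rho_prob: "prob_space \<rho>"
    and rho_borel: "sets \<rho> = sets borel"
    and rho_nondeg: "\<forall>c. \<rho> \<noteq> return borel c"
    and rho_exp: "\<forall>a>0. \<forall>b. integrable \<rho> (\<lambda>x. exp (a * x\<^sup>2 / 2 + b * x))"
    and J_pos: "J > 0"
    and glob_max: "\<forall>x. f_CW \<rho> J h x \<le> f_CW \<rho> J h \<mu>"
    and type: "has_type_strength (f_CW \<rho> J h) \<mu> k lam"
  shows "\<exists>A>0. \<forall>a. 0 < a \<and> a < A \<longrightarrow>
    (let law = (\<lambda>n. distr
                 (uniform_measure (P_N \<rho> J h (Suc n))
                    {\<sigma> \<in> space (P_N \<rho> J h (Suc n)). \<bar>m_N (Suc n) \<sigma> - \<mu>\<bar> \<le> a})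
                 borel (S_bar k \<mu> (Suc n)))
     in (if k = 1 then
           1 / (- lam) - 1 / J > 0 \<and>
           weak_conv_m law (density lborel (normal_density 0 (sqrt (1 / (- lam) - 1 / J))))
         else
           weak_conv_m law
             (density lborel (\<lambda>x. ennreal (exp (lam / fact (2 * k) * x ^ (2 * k)) /
                (\<integral>y. exp (lam / fact (2 * k) * y ^ (2 * k)) \<partial>lborel))))))"
proof -
  interpret \<rho>: prob_space \<rho> by (rule rho_prob)
  interpret curie_weiss \<rho> J h
    using rho_borel rho_exp J_pos by unfold_locales auto
  have k: "1 \<le> k" and lam: "lam < 0" using type by (auto simp: has_type_strength_def)
  have max: "f x \<le> f \<mu>" for x using glob_max by simp
  let ?b = "\<lambda>n. real (Suc n) powr (1 / (2 * real k))"
  show ?thesis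
  proof (cases "k = 1")
    case True
    define v where "v = - lam"
    have "- J < lam"
      using second_deriv_f_gt[of \<mu>] rho_nondeg type True by (simp add: has_type_strength_def)
    then have v: "0 < v" "v < J" using lam by (auto simp: v_def)
    define s where "s = sqrt (1 / v - 1 / J)"
    have s: "0 < 1 / v - 1 / J" "0 < s" "s\<^sup>2 = 1 / v - 1 / J"
      using v J_pos by (auto simp: s_def field_simps)
    have power: "exp (lam / fact (2 * k) * x ^ (2 * k)) = exp (- (v * x\<^sup>2 / 2))" for x
      unfolding True v_def by (simp add: numeral_2_eq_2 fact_numeral)
    have "\<exists>A>0. \<forall>a. 0 < a \<and> a < A \<longrightarrow> weak_conv_m
      (\<lambda>n. distr (uniform_measure (P_N \<rho> J h (Suc n)) (window (Suc n) \<mu> a)) borel (S_bar k \<mu> (Suc n)))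
      (density lborel (normal_density 0 s))"
    proof (rule conditional_weak_limit[OF max type, where E = "\<lambda>t. exp (- t\<^sup>2 / (2 * J))"])
      show "(\<lambda>n. exp (- (t * ?b n)\<^sup>2 / (2 * (real (Suc n) * J)))) \<longlonglongrightarrow> exp (- t\<^sup>2 / (2 * J))" for t
      proof -
        have "(t * ?b n)\<^sup>2 = t\<^sup>2 * real (Suc n)" for n
          using powr_scale(1)[OF k, of n] True by (simp add: power_mult_distrib del: of_nat_Suc)
        then show ?thesis by (simp del: of_nat_Suc)
      qed
      show "real_distribution (density lborel (normal_density 0 s))"
        using s(2) by (intro real_distribution.intro real_distribution_axioms.intro prob_space_normal_density) auto
      fix t
      have "char (density lborel (normal_density 0 s)) t * exp (- t\<^sup>2 / (2 * J)) = complex_of_real (exp (- t\<^sup>2 / (2 * v)))"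
      proof -
        \<comment> \<open>The variance \<open>1 / v\<close> of the Laplace limit splits into
          \<open>s\<^sup>2\<close> from the magnetization and \<open>1 / J\<close> from the
          auxiliary Gaussian.\<close>
        have "- (s * t)\<^sup>2 / 2 + - t\<^sup>2 / (2 * J) = - t\<^sup>2 / (2 * v)"
          unfolding power_mult_distrib s(3) using v J_pos by (simp add: field_simps)
        then show ?thesis
          unfolding char_normal_density[OF s(2)] of_real_mult[symmetric] exp_add[symmetric] by simp
      qed
      also have "\<dots> = (CLBINT x. exp (lam / fact (2 * k) * x ^ (2 * k)) *\<^sub>R iexp (t * x)) /
          (LBINT x. exp (lam / fact (2 * k) * x ^ (2 * k)))"
        unfolding power gaussian_integral[OF v(1)] scaleR_conv_of_real
        using gaussian_fourier(2)[OF v(1), of t] v(1) by (simp add: mult.commute)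
      finally show "char (density lborel (normal_density 0 s)) t * exp (- t\<^sup>2 / (2 * J)) =
          (CLBINT x. exp (lam / fact (2 * k) * x ^ (2 * k)) *\<^sub>R iexp (t * x)) /
          (LBINT x. exp (lam / fact (2 * k) * x ^ (2 * k)))" .
    qed simp
    then show ?thesis
      using True s unfolding s_def v_def Let_def by simp
  next
    case False
    let ?l = "LBINT x. exp (lam / fact (2 * k) * x ^ (2 * k))"
    let ?M = "density lborel (\<lambda>x. ennreal (exp (lam / fact (2 * k) * x ^ (2 * k)) / ?l))"
    have l: "0 < ?l" and int: "integrable lborel (\<lambda>x. exp (lam / fact (2 * k) * x ^ (2 * k)))"
      using even_power_density_pos[OF lam k] by auto
    have "\<exists>A>0. \<forall>a. 0 < a \<and> a < A \<longrightarrow> weak_conv_m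
      (\<lambda>n. distr (uniform_measure (P_N \<rho> J h (Suc n)) (window (Suc n) \<mu> a)) borel (S_bar k \<mu> (Suc n))) ?M"
    proof (rule conditional_weak_limit[OF max type, where E = "\<lambda>t. 1"])
      show "(\<lambda>n. exp (- (t * ?b n)\<^sup>2 / (2 * (real (Suc n) * J)))) \<longlonglongrightarrow> 1" for t
      proof -
        \<comment> \<open>The fluctuations now have a larger scale than the auxiliary Gaussian,
          whose contribution vanishes in the limit.\<close>
        have "1 / real k - 1 < 0" using False k by simp
        then have "(\<lambda>n. real (Suc n) powr (1 / real k - 1)) \<longlonglongrightarrow> 0"
          by real_asymp
        then have "(\<lambda>n. exp (- t\<^sup>2 / (2 * J) * real (Suc n) powr (1 / real k - 1))) \<longlonglongrightarrow> exp (- t\<^sup>2 / (2 * J) * 0)"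
          by (intro tendsto_intros)
        moreover have "- (t * ?b n)\<^sup>2 / (2 * (real (Suc n) * J)) = - t\<^sup>2 / (2 * J) * real (Suc n) powr (1 / real k - 1)" for n
        proof -
          have "(?b n)\<^sup>2 = real (Suc n) powr (1 / real k)"
            by (simp add: powr_power del: of_nat_Suc)
          then show ?thesis
            by (simp add: power_mult_distrib powr_diff del: of_nat_Suc)
        qed
        ultimately show ?thesis by (simp del: of_nat_Suc)
      qed
      show "real_distribution ?M"
      proof (intro real_distribution.intro real_distribution_axioms.intro prob_spaceI)
        have "emeasure ?M (space ?M) = (\<integral>\<^sup>+x. ennreal (exp (lam / fact (2 * k) * x ^ (2 * k)) / ?l) \<partial>lborel)"
          by (simp add: emeasure_density)
        also have "\<dots> = ennreal (LBINT x. exp (lam / fact (2 * k) * x ^ (2 * k)) / ?l)"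
          using l by (intro nn_integral_eq_integral integrable_divide int) (auto simp: less_imp_le)
        also have "\<dots> = 1" using l by simp
        finally show "emeasure ?M (space ?M) = 1" .
      qed simp
      fix t
      have "char ?M t = (CLBINT x. (exp (lam / fact (2 * k) * x ^ (2 * k)) / ?l) *\<^sub>R iexp (t * x))"
        unfolding char_def using l by (intro integral_density) (auto simp: less_imp_le)
      also have "\<dots> = (CLBINT x. (exp (lam / fact (2 * k) * x ^ (2 * k)) *\<^sub>R iexp (t * x)) / ?l)"
        by (simp add: scaleR_conv_of_real)
      also have "\<dots> = (CLBINT x. exp (lam / fact (2 * k) * x ^ (2 * k)) *\<^sub>R iexp (t * x)) / ?l"
        by (rule integral_divide_zero)
      finally show "char ?M t * complex_of_real 1 = (CLBINT x. exp (lam / fact (2 * k) * x ^ (2 * k)) *\<^sub>R iexp (t * x)) / ?l"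
        by simp
    qed simp
    then show ?thesis
      using False by (simp add: Let_def)
  qed
qed

end
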